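(* The Cuntz algebra $\mathcal{O}_\infty$ is nuclear, i.e. $\mathcal{O}_\infty\otimes_{\min}\mathcal{A}=\mathcal{O}_\infty\otimes_{\max}\mathcal{A}$ for every unital $C^*$-algebra $\mathcal{A}$.
   Context: $\mathcal{O}_\infty$ is the universal $C^*$-algebra generated by a sequence of isometries $S_1,S_2,\dots$ with $\sum_{i=1}^kS_iS_i^*\le I$ for every $k<\infty$. $\otimes_{\min}$ and $\otimes_{\max}$ are the minimal and maximal $C^*$-tensor products. *)

theory Defs
  imports "HOL-Analysis.Analysis"
begin

section \<open>Unital C*-algebras\<close>

class scaleC = scaleR +
  fixes scaleC :: "complex \<Rightarrow> 'a \<Rightarrow> 'a" (infixr "*\<^sub>C" 75)
  assumes scaleR_scaleC: "r *\<^sub>R x = complex_of_real r *\<^sub>C x"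

class complex_vector = scaleC + ab_group_add +
  assumes scaleC_add_right: "a *\<^sub>C (x + y) = a *\<^sub>C x + a *\<^sub>C y"
    and scaleC_add_left: "(a + b) *\<^sub>C x = a *\<^sub>C x + b *\<^sub>C x"
    and scaleC_scaleC [simp]: "a *\<^sub>C b *\<^sub>C x = (a * b) *\<^sub>C x"
    and scaleC_one [simp]: "1 *\<^sub>C x = x"

class complex_normed_vector = complex_vector + real_normed_vector +
  assumes norm_scaleC [simp]: "norm (a *\<^sub>C x) = cmod a * norm x"

text \<open>Algebras are unital with \<open>1 \<noteq> 0\<close> (this is part of \<^class>\<open>real_normed_algebra_1\<close>).\<close>

class cstar_algebra = complex_normed_vector + real_normed_algebra_1 + banach +
  fixes star :: "'a \<Rightarrow> 'a" ("_\<^sup>\<star>" [1000] 1000)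
  assumes mult_scaleC_left [simp]: "(a *\<^sub>C x) * y = a *\<^sub>C (x * y)"
    and mult_scaleC_right [simp]: "x * (a *\<^sub>C y) = a *\<^sub>C (x * y)"
    and star_star [simp]: "(x\<^sup>\<star>)\<^sup>\<star> = x"
    and star_add: "(x + y)\<^sup>\<star> = x\<^sup>\<star> + y\<^sup>\<star>"
    and star_scaleC: "(a *\<^sub>C x)\<^sup>\<star> = cnj a *\<^sub>C x\<^sup>\<star>"
    and star_mult: "(x * y)\<^sup>\<star> = y\<^sup>\<star> * x\<^sup>\<star>"
    and cstar_identity: "norm (x\<^sup>\<star> * x) = (norm x)\<^sup>2"

definition cstar_le :: "'a::cstar_algebra \<Rightarrow> 'a \<Rightarrow> bool" (infix "\<le>\<^sub>*" 50)
  where "a \<le>\<^sub>* b \<longleftrightarrow> (\<exists>c. b - a = c\<^sup>\<star> * c)"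

definition clinear :: "('a::complex_vector \<Rightarrow> 'b::complex_vector) \<Rightarrow> bool"
  where "clinear f \<longleftrightarrow> (\<forall>x y. f (x + y) = f x + f y) \<and> (\<forall>c x. f (c *\<^sub>C x) = c *\<^sub>C f x)"

definition unital_star_hom :: "('a::cstar_algebra \<Rightarrow> 'b::cstar_algebra) \<Rightarrow> bool"
  where "unital_star_hom \<pi> \<longleftrightarrow> clinear \<pi> \<and> (\<forall>x y. \<pi> (x * y) = \<pi> x * \<pi> y) \<and>
    (\<forall>x. \<pi> (x\<^sup>\<star>) = (\<pi> x)\<^sup>\<star>) \<and> \<pi> 1 = 1"

definition cstar_subalgebra :: "'a::cstar_algebra set \<Rightarrow> bool"
  where "cstar_subalgebra B \<longleftrightarrow> closed B \<and> 1 \<in> B \<and>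
    (\<forall>x\<in>B. \<forall>y\<in>B. x + y \<in> B \<and> x * y \<in> B) \<and> (\<forall>x\<in>B. \<forall>c. c *\<^sub>C x \<in> B \<and> x\<^sup>\<star> \<in> B)"

definition cstar_generated :: "'a::cstar_algebra set \<Rightarrow> 'a set"
  where "cstar_generated X = \<Inter> {B. cstar_subalgebra B \<and> X \<subseteq> B}"


section \<open>The Hilbert spaces \<open>\<ell>\<^sup>2(I)\<close>\<close>

typedef 'i ell2 = "{f :: 'i \<Rightarrow> complex. (\<lambda>i. (cmod (f i))\<^sup>2) summable_on UNIV}"
  morphisms ell2_apply Abs_ell2
  by (rule exI[of _ "\<lambda>_. 0"]) simp

setup_lifting type_definition_ell2

lemma ell2_prod_abs_summable:
  fixes f g :: "'i \<Rightarrow> complex"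
  assumes "(\<lambda>i. (cmod (f i))\<^sup>2) summable_on UNIV" "(\<lambda>i. (cmod (g i))\<^sup>2) summable_on UNIV"
  shows "(\<lambda>i. cmod (cnj (f i) * g i)) summable_on UNIV"
  using abs_summable_product[of "\<lambda>i. cnj (f i)" UNIV g] assms
  by (simp add: power2_eq_square norm_mult)

lemma ell2_prod_summable:
  fixes f g :: "'i \<Rightarrow> complex"
  assumes "(\<lambda>i. (cmod (f i))\<^sup>2) summable_on UNIV" "(\<lambda>i. (cmod (g i))\<^sup>2) summable_on UNIV"
  shows "(\<lambda>i. cnj (f i) * g i) summable_on UNIV"
  by (rule abs_summable_summable[OF ell2_prod_abs_summable[OF assms]])

lemma ell2_sum_closed:
  fixes f g :: "'i \<Rightarrow> complex"
  assumes "(\<lambda>i. (cmod (f i))\<^sup>2) summable_on UNIV" "(\<lambda>i. (cmod (g i))\<^sup>2) summable_on UNIV"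
  shows "(\<lambda>i. (cmod (f i + g i))\<^sup>2) summable_on UNIV"
proof (rule summable_on_comparison_test)
  show "(\<lambda>i. 2 * (cmod (f i))\<^sup>2 + 2 * (cmod (g i))\<^sup>2) summable_on UNIV"
    by (intro summable_on_add summable_on_cmult_right assms)
  fix i
  have "(cmod (f i + g i))\<^sup>2 \<le> (cmod (f i) + cmod (g i))\<^sup>2"
    by (intro power_mono norm_triangle_ineq) auto
  also have "\<dots> \<le> 2 * (cmod (f i))\<^sup>2 + 2 * (cmod (g i))\<^sup>2"
    using sum_squares_bound[of "cmod (f i)" "cmod (g i)"] by (simp add: power2_sum)
  finally show "(cmod (f i + g i))\<^sup>2 \<le> 2 * (cmod (f i))\<^sup>2 + 2 * (cmod (g i))\<^sup>2" .
qed auto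

instantiation ell2 :: (type) complex_vector
begin
lift_definition zero_ell2 :: "'a ell2" is "\<lambda>_. 0" by simp
lift_definition plus_ell2 :: "'a ell2 \<Rightarrow> 'a ell2 \<Rightarrow> 'a ell2" is "\<lambda>f g i. f i + g i"
  by (rule ell2_sum_closed)
lift_definition uminus_ell2 :: "'a ell2 \<Rightarrow> 'a ell2" is "\<lambda>f i. - f i" by simp
lift_definition minus_ell2 :: "'a ell2 \<Rightarrow> 'a ell2 \<Rightarrow> 'a ell2" is "\<lambda>f g i. f i - g i"
  by (drule (1) ell2_sum_closed[where g = "\<lambda>i. - g i" for g, simplified]) auto
lift_definition scaleC_ell2 :: "complex \<Rightarrow> 'a ell2 \<Rightarrow> 'a ell2" is "\<lambda>c f i. c * f i"
  by (simp add: norm_mult power_mult_distrib summable_on_cmult_right)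
definition scaleR_ell2 :: "real \<Rightarrow> 'a ell2 \<Rightarrow> 'a ell2" where
  "scaleR_ell2 r x = complex_of_real r *\<^sub>C x"
instance
  by standard (simp add: scaleR_ell2_def | transfer, simp add: fun_eq_iff algebra_simps)+
end

text \<open>The inner product is linear in the second argument.\<close>

lift_definition cinner :: "'i ell2 \<Rightarrow> 'i ell2 \<Rightarrow> complex"
  is "\<lambda>f g. \<Sum>\<^sub>\<infinity>i. cnj (f i) * g i" .

lemma cinner_add_right: "cinner x (y + z) = cinner x y + cinner x z"
  by transfer (simp add: distrib_left infsum_add ell2_prod_summable)

lemma cinner_commute: "cnj (cinner x y) = cinner y x"
  by transfer (simp flip: infsum_cnj add: mult.commute)

lemma cinner_scaleC_right [simp]: "cinner x (c *\<^sub>C y) = c * cinner x y"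
  unfolding cinner.rep_eq scaleC_ell2.rep_eq
  by (subst infsum_cmult_right'[symmetric]) (rule infsum_cong, simp)

lemma cinner_add_left: "cinner (x + y) z = cinner x z + cinner y z"
  by (metis cinner_add_right cinner_commute complex_cnj_add)

lemma cinner_scaleC_left [simp]: "cinner (c *\<^sub>C x) y = cnj c * cinner x y"
  by (metis cinner_scaleC_right cinner_commute complex_cnj_mult)

lemma cinner_self: "cinner x x = complex_of_real (\<Sum>\<^sub>\<infinity>i. (cmod (ell2_apply x i))\<^sup>2)"
proof -
  have "cinner x x = (\<Sum>\<^sub>\<infinity>i. complex_of_real ((cmod (ell2_apply x i))\<^sup>2))"
    unfolding cinner.rep_eq
    by (intro infsum_cong) (simp only: complex_norm_square mult.commute)
  also have "\<dots> = complex_of_real (\<Sum>\<^sub>\<infinity>i. (cmod (ell2_apply x i))\<^sup>2)"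
    by (intro infsumI has_sum_of_real has_sum_infsum) (use ell2_apply in blast)
  finally show ?thesis .
qed

instantiation ell2 :: (type) real_inner
begin
definition inner_ell2 :: "'a ell2 \<Rightarrow> 'a ell2 \<Rightarrow> real" where "inner_ell2 x y = Re (cinner x y)"
definition norm_ell2 :: "'a ell2 \<Rightarrow> real" where "norm_ell2 x = sqrt (inner x x)"
definition sgn_ell2 :: "'a ell2 \<Rightarrow> 'a ell2" where "sgn_ell2 x = inverse (norm x) *\<^sub>R x"
definition dist_ell2 :: "'a ell2 \<Rightarrow> 'a ell2 \<Rightarrow> real" where "dist_ell2 x y = norm (x - y)"
definition uniformity_ell2 :: "('a ell2 \<times> 'a ell2) filter"
  where "uniformity_ell2 = (INF e\<in>{0<..}. principal {(x, y). dist x y < e})"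
definition open_ell2 :: "'a ell2 set \<Rightarrow> bool"
  where "open_ell2 U \<longleftrightarrow> (\<forall>x\<in>U. \<forall>\<^sub>F (x', y) in uniformity. x' = x \<longrightarrow> y \<in> U)"
instance
proof
  fix x y z :: "'a ell2" and a b r :: real
  show "a *\<^sub>R (x + y) = a *\<^sub>R x + a *\<^sub>R y" by (simp add: scaleR_scaleC scaleC_add_right)
  show "(a + b) *\<^sub>R x = a *\<^sub>R x + b *\<^sub>R x" by (simp add: scaleR_scaleC scaleC_add_left)
  show "a *\<^sub>R b *\<^sub>R x = (a * b) *\<^sub>R x" by (simp add: scaleR_scaleC)
  show "1 *\<^sub>R x = x" by (simp add: scaleR_scaleC)
  show "inner x y = inner y x"
    unfolding inner_ell2_def by (subst cinner_commute[of y x, symmetric]) simp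
  show "inner (x + y) z = inner x z + inner y z" by (simp add: inner_ell2_def cinner_add_left)
  show "inner (r *\<^sub>R x) y = r * inner x y" by (simp add: inner_ell2_def scaleR_scaleC)
  show "0 \<le> inner x x" by (simp add: inner_ell2_def cinner_self infsum_nonneg)
  show "inner x x = 0 \<longleftrightarrow> x = 0"
  proof
    assume "inner x x = 0"
    then have "(\<Sum>\<^sub>\<infinity>i. (cmod (ell2_apply x i))\<^sup>2) \<le> 0" by (simp add: inner_ell2_def cinner_self)
    then have "(cmod (ell2_apply x i))\<^sup>2 = 0" for i
      using nonneg_infsum_le_0D[of "\<lambda>i. (cmod (ell2_apply x i))\<^sup>2" UNIV i] ell2_apply[of x] by auto
    then show "x = 0" by transfer auto
  next
    show "x = 0 \<Longrightarrow> inner x x = 0" by (simp add: inner_ell2_def cinner_self zero_ell2.rep_eq)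
  qed
qed (simp_all add: norm_ell2_def sgn_ell2_def dist_ell2_def uniformity_ell2_def open_ell2_def)
end

lemma norm_ell2_square: "(norm x)\<^sup>2 = (\<Sum>\<^sub>\<infinity>i. (cmod (ell2_apply x i))\<^sup>2)"
  by (simp add: power2_norm_eq_inner inner_ell2_def cinner_self)

lemma cinner_self_norm: "cinner x x = complex_of_real ((norm x)\<^sup>2)"
  by (simp add: norm_ell2_square cinner_self)

lemma sum_le_norm_ell2:
  assumes "finite F"
  shows "(\<Sum>i\<in>F. (cmod (ell2_apply x i))\<^sup>2) \<le> (norm x)\<^sup>2"
  unfolding norm_ell2_square by (rule finite_sum_le_infsum) (use ell2_apply[of x] assms in auto)

lemma cmod_apply_le_norm: "cmod (ell2_apply x i) \<le> norm x"
  using sum_le_norm_ell2[of "{i}" x] by (simp add: power2_le_iff_abs_le)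

instance ell2 :: (type) complex_normed_vector
proof
  fix a :: complex and x :: "'a ell2"
  have "(norm (a *\<^sub>C x))\<^sup>2 = (cmod a * norm x)\<^sup>2"
    unfolding norm_ell2_square power_mult_distrib
    by (simp add: scaleC_ell2.rep_eq norm_mult power_mult_distrib infsum_cmult_right')
  then show "norm (a *\<^sub>C x) = cmod a * norm x" by (simp add: power2_eq_iff_nonneg)
qed

lemma ell2_boundedI:
  assumes "\<And>F. finite F \<Longrightarrow> (\<Sum>i\<in>F. (cmod (f i))\<^sup>2) \<le> B"
  shows "(\<lambda>i. (cmod (f i))\<^sup>2) summable_on UNIV" "(\<Sum>\<^sub>\<infinity>i. (cmod (f i))\<^sup>2) \<le> B"
proof -
  show s: "(\<lambda>i. (cmod (f i))\<^sup>2) summable_on UNIV"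
    by (rule nonneg_bdd_above_summable_on) (use assms in \<open>auto intro!: bdd_aboveI\<close>)
  show "(\<Sum>\<^sub>\<infinity>i. (cmod (f i))\<^sup>2) \<le> B"
    by (rule infsum_le_finite_sums[OF s]) (use assms in auto)
qed

instance ell2 :: (type) banach
proof
  fix X :: "nat \<Rightarrow> 'a ell2"
  assume X: "Cauchy X"
  have "Cauchy (\<lambda>n. ell2_apply (X n) i)" for i
    unfolding Cauchy_def
  proof (intro allI impI)
    fix e :: real assume "0 < e"
    with X obtain M where M: "\<forall>m\<ge>M. \<forall>n\<ge>M. norm (X m - X n) < e"
      unfolding Cauchy_def dist_norm by blast
    show "\<exists>M. \<forall>m\<ge>M. \<forall>n\<ge>M. dist (ell2_apply (X m) i) (ell2_apply (X n) i) < e"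
      using M cmod_apply_le_norm[of "X m - X n" i for m n]
      by (intro exI[of _ M]) (simp add: dist_norm minus_ell2.rep_eq, meson le_less_trans)
  qed
  then have "\<exists>l. (\<lambda>n. ell2_apply (X n) i) \<longlonglongrightarrow> l" for i
    by (simp add: Cauchy_convergent_iff convergent_def)
  then obtain l where l: "\<And>i. (\<lambda>n. ell2_apply (X n) i) \<longlonglongrightarrow> l i" by metis
  have fin: "(\<Sum>i\<in>F. (cmod (ell2_apply (X m) i - l i))\<^sup>2) \<le> e\<^sup>2"
    if M: "\<forall>m\<ge>M. \<forall>n\<ge>M. norm (X m - X n) < e" and "m \<ge> M" "finite F" for M e m F
  proof (rule LIMSEQ_le_const2)
    show "(\<lambda>n. \<Sum>i\<in>F. (cmod (ell2_apply (X m) i - ell2_apply (X n) i))\<^sup>2) \<longlonglongrightarrow>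
        (\<Sum>i\<in>F. (cmod (ell2_apply (X m) i - l i))\<^sup>2)"
      by (intro tendsto_intros l)
    show "\<exists>N. \<forall>n\<ge>N. (\<Sum>i\<in>F. (cmod (ell2_apply (X m) i - ell2_apply (X n) i))\<^sup>2) \<le> e\<^sup>2"
    proof (intro exI[of _ M] allI impI)
      fix n assume "M \<le> n"
      have "(\<Sum>i\<in>F. (cmod (ell2_apply (X m) i - ell2_apply (X n) i))\<^sup>2) \<le> (norm (X m - X n))\<^sup>2"
        using sum_le_norm_ell2[OF \<open>finite F\<close>, of "X m - X n"] by (simp add: minus_ell2.rep_eq)
      also have "\<dots> \<le> e\<^sup>2" using M \<open>m \<ge> M\<close> \<open>M \<le> n\<close> by (intro power_mono) (auto simp: less_imp_le)
      finally show "(\<Sum>i\<in>F. (cmod (ell2_apply (X m) i - ell2_apply (X n) i))\<^sup>2) \<le> e\<^sup>2" .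
    qed
  qed
  obtain M where M: "\<forall>m\<ge>M. \<forall>n\<ge>M. norm (X m - X n) < 1"
    using X zero_less_one unfolding Cauchy_def dist_norm by blast
  have "(\<lambda>i. (cmod (l i - ell2_apply (X M) i))\<^sup>2) summable_on UNIV"
    by (rule ell2_boundedI) (use fin[OF M order_refl] in \<open>simp add: norm_minus_commute\<close>)
  from ell2_sum_closed[OF this, of "ell2_apply (X M)"]
  have "(\<lambda>i. (cmod (l i))\<^sup>2) summable_on UNIV" using ell2_apply[of "X M"] by simp
  then have L: "ell2_apply (Abs_ell2 l) = l" by (simp add: Abs_ell2_inverse)
  have "X \<longlonglongrightarrow> Abs_ell2 l"
    unfolding LIMSEQ_iff
  proof (intro allI impI)
    fix r :: real assume "0 < r"
    then have "0 < r / 2" by simp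
    with X obtain M where M: "\<forall>m\<ge>M. \<forall>n\<ge>M. norm (X m - X n) < r / 2"
      unfolding Cauchy_def dist_norm by blast
    have "norm (X m - Abs_ell2 l) < r" if "m \<ge> M" for m
    proof -
      have "(norm (X m - Abs_ell2 l))\<^sup>2 \<le> (r / 2)\<^sup>2"
        unfolding norm_ell2_square minus_ell2.rep_eq L
        by (rule ell2_boundedI) (rule fin[OF M that])
      then have "norm (X m - Abs_ell2 l) \<le> r / 2" using \<open>0 < r / 2\<close> by (simp add: power2_le_iff_abs_le)
      then show ?thesis using \<open>0 < r\<close> by simp
    qed
    then show "\<exists>no. \<forall>n\<ge>no. norm (X n - Abs_ell2 l) < r" by blast
  qed
  then show "convergent X" by (auto simp: convergent_def)
qed


lift_definition ell2_basis :: "'i \<Rightarrow> 'i ell2" is "\<lambda>i j. of_bool (i = j)"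
proof -
  fix i :: 'i
  have "(\<lambda>j. (cmod (of_bool (i = j)))\<^sup>2) = (\<lambda>j. of_bool (j = i))" by auto
  then show "(\<lambda>j. (cmod (of_bool (i = j)))\<^sup>2) summable_on UNIV"
    by (simp only:) (rule finite_nonzero_values_imp_summable_on, auto)
qed

lemma cinner_basis_left [simp]: "cinner (ell2_basis i) x = ell2_apply x i"
proof -
  have "cinner (ell2_basis i) x = (\<Sum>\<^sub>\<infinity>j\<in>{i}. ell2_apply x j)"
    unfolding cinner.rep_eq ell2_basis.rep_eq by (rule infsum_cong_neutral) auto
  then show ?thesis by simp
qed

lemma norm_ell2_basis [simp]: "norm (ell2_basis i) = 1"
proof -
  have "complex_of_real ((norm (ell2_basis i))\<^sup>2) = 1"
    by (simp only: cinner_self_norm[symmetric] cinner_basis_left ell2_basis.rep_eq) simp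
  then have "(norm (ell2_basis i))\<^sup>2 = 1" by (simp only: of_real_eq_1_iff)
  then show ?thesis by (simp add: power2_eq_1_iff) (smt (verit) norm_ge_zero)
qed

lemma cmod_cinner_le: "cmod (cinner x y) \<le> norm x * norm y"
proof -
  obtain c where c: "cmod c = 1" "c * cinner x y = complex_of_real (cmod (cinner x y))"
  proof (cases "cinner x y = 0")
    case False
    then show ?thesis
      by (intro that[of "cnj (cinner x y) / cmod (cinner x y)"])
        (simp_all add: norm_divide complex_norm_square[symmetric] power2_eq_square field_simps)
  qed (auto intro: that[of 1])
  have "cmod (cinner x y) = inner x (c *\<^sub>C y)" by (simp add: inner_ell2_def c)
  also have "\<dots> \<le> norm x * norm (c *\<^sub>C y)" by (rule norm_cauchy_schwarz)
  finally show ?thesis by (simp add: c)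
qed

lemma bounded_linear_cinner_right: "bounded_linear (cinner x)"
  by (rule bounded_linear_intro[where K = "norm x"])
    (simp_all add: cinner_add_right scaleR_scaleC scaleR_conv_of_real cmod_cinner_le mult.commute[of "norm y" "norm x" for y])

lemma ell2_apply_sum: "ell2_apply (sum f F) j = (\<Sum>i\<in>F. ell2_apply (f i) j)"
  by (induction F rule: infinite_finite_induct) (simp_all add: zero_ell2.rep_eq plus_ell2.rep_eq)

lemma norm_trunc_diff:
  assumes "finite F"
  shows "(norm (x - (\<Sum>i\<in>F. ell2_apply x i *\<^sub>C ell2_basis i)))\<^sup>2 =
    (norm x)\<^sup>2 - (\<Sum>i\<in>F. (cmod (ell2_apply x i))\<^sup>2)"
proof -
  have s: "(\<lambda>i. (cmod (ell2_apply x i))\<^sup>2) summable_on A" for A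
    using ell2_apply[of x] by (auto intro: summable_on_subset_banach)
  have "(\<Sum>i\<in>F. ell2_apply x i * of_bool (i = j)) = (if j \<in> F then ell2_apply x j else 0)" for j
    using assms by (simp add: of_bool_def if_distrib cong: if_cong)
  then have "ell2_apply (x - (\<Sum>i\<in>F. ell2_apply x i *\<^sub>C ell2_basis i)) j =
      (if j \<in> F then 0 else ell2_apply x j)" for j
    by (simp add: minus_ell2.rep_eq ell2_apply_sum scaleC_ell2.rep_eq ell2_basis.rep_eq)
  then have "(norm (x - (\<Sum>i\<in>F. ell2_apply x i *\<^sub>C ell2_basis i)))\<^sup>2 =
      (\<Sum>\<^sub>\<infinity>j\<in>- F. (cmod (ell2_apply x j))\<^sup>2)"
    unfolding norm_ell2_square by (intro infsum_cong_neutral) auto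
  also have "\<dots> = (norm x)\<^sup>2 - (\<Sum>i\<in>F. (cmod (ell2_apply x i))\<^sup>2)"
    using infsum_Un_disjoint[OF s s, of F "- F"] assms by (simp add: norm_ell2_square)
  finally show ?thesis .
qed

lemma ell2_has_sum_basis: "((\<lambda>i. ell2_apply x i *\<^sub>C ell2_basis i) has_sum x) UNIV"
proof -
  have "((\<lambda>F. \<Sum>i\<in>F. (cmod (ell2_apply x i))\<^sup>2) \<longlongrightarrow> (norm x)\<^sup>2) (finite_subsets_at_top UNIV)"
    unfolding norm_ell2_square by (rule infsum_tendsto) (use ell2_apply in blast)
  then have "((\<lambda>F. (norm x)\<^sup>2 - (\<Sum>i\<in>F. (cmod (ell2_apply x i))\<^sup>2)) \<longlongrightarrow> (norm x)\<^sup>2 - (norm x)\<^sup>2)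
      (finite_subsets_at_top UNIV)"
    by (intro tendsto_intros)
  then have "((\<lambda>F. sqrt ((norm x)\<^sup>2 - (\<Sum>i\<in>F. (cmod (ell2_apply x i))\<^sup>2))) \<longlongrightarrow> 0)
      (finite_subsets_at_top UNIV)"
    using tendsto_real_sqrt by fastforce
  moreover have "\<forall>\<^sub>F F in finite_subsets_at_top UNIV.
      sqrt ((norm x)\<^sup>2 - (\<Sum>i\<in>F. (cmod (ell2_apply x i))\<^sup>2)) =
      norm ((\<Sum>i\<in>F. ell2_apply x i *\<^sub>C ell2_basis i) - x)"
    by (rule eventually_finite_subsets_at_top_weakI)
      (simp flip: norm_trunc_diff add: norm_minus_commute)
  ultimately have "((\<lambda>F. norm ((\<Sum>i\<in>F. ell2_apply x i *\<^sub>C ell2_basis i) - x)) \<longlongrightarrow> 0)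
      (finite_subsets_at_top UNIV)"
    by (rule Lim_transform_eventually)
  then show ?thesis
    unfolding has_sum_def by (simp add: tendsto_norm_zero_iff LIM_zero_iff)
qed

lemma cinner_eqI: "(\<And>x. cinner x u = cinner x v) \<Longrightarrow> u = v"
  by (metis cinner_basis_left ell2_apply_inject ext)

lift_definition ell2_tensor :: "'i ell2 \<Rightarrow> 'j ell2 \<Rightarrow> ('i \<times> 'j) ell2" (infixr "\<otimes>\<^sub>h" 75)
  is "\<lambda>f g (i, j). f i * g j"
proof -
  fix f :: "'i \<Rightarrow> complex" and g :: "'j \<Rightarrow> complex"
  assume f: "(\<lambda>i. (cmod (f i))\<^sup>2) summable_on UNIV" and g: "(\<lambda>i. (cmod (g i))\<^sup>2) summable_on UNIV"
  show "(\<lambda>p. (cmod (case p of (i, j) \<Rightarrow> f i * g j))\<^sup>2) summable_on UNIV"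
  proof (rule ell2_boundedI(1))
    fix F :: "('i \<times> 'j) set" assume F: "finite F"
    have "(\<Sum>p\<in>F. (cmod (case p of (i, j) \<Rightarrow> f i * g j))\<^sup>2) \<le>
        (\<Sum>p\<in>fst ` F \<times> snd ` F. (cmod (case p of (i, j) \<Rightarrow> f i * g j))\<^sup>2)"
      using F by (intro sum_mono2) force+
    also have "\<dots> = (\<Sum>i\<in>fst ` F. (cmod (f i))\<^sup>2) * (\<Sum>j\<in>snd ` F. (cmod (g j))\<^sup>2)"
      by (simp add: sum_product sum.cartesian_product norm_mult power_mult_distrib case_prod_unfold)
    also have "\<dots> \<le> (\<Sum>\<^sub>\<infinity>i. (cmod (f i))\<^sup>2) * (\<Sum>\<^sub>\<infinity>j. (cmod (g j))\<^sup>2)"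
      using F by (intro mult_mono finite_sum_le_infsum f g infsum_nonneg sum_nonneg) auto
    finally show "(\<Sum>p\<in>F. (cmod (case p of (i, j) \<Rightarrow> f i * g j))\<^sup>2) \<le>
      (\<Sum>\<^sub>\<infinity>i. (cmod (f i))\<^sup>2) * (\<Sum>\<^sub>\<infinity>j. (cmod (g j))\<^sup>2)" .
  qed
qed

lemma ell2_basis_pair: "ell2_basis (i, j) = ell2_basis i \<otimes>\<^sub>h ell2_basis j"
  by transfer (auto simp: fun_eq_iff)

lifting_forget ell2.lifting


section \<open>Bounded operators on \<open>\<ell>\<^sup>2(I)\<close>\<close>

typedef 'i bop = "{T :: 'i ell2 \<Rightarrow>\<^sub>L 'i ell2. \<forall>c x. T (c *\<^sub>C x) = c *\<^sub>C T x}"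
  morphisms blinfun_of_bop Abs_bop
  by (rule exI[of _ 0]) (auto simp: scaleC_add_right[of _ 0 0, simplified])

setup_lifting type_definition_bop

lift_definition bop_apply :: "'i bop \<Rightarrow> 'i ell2 \<Rightarrow> 'i ell2" (infixr "\<bullet>\<^sub>v" 70) is blinfun_apply .

lemma bop_apply_scaleC [simp]: "T \<bullet>\<^sub>v (c *\<^sub>C x) = c *\<^sub>C (T \<bullet>\<^sub>v x)"
  by transfer simp

lemma bounded_linear_bop_apply: "bounded_linear (bop_apply T)"
  by transfer (rule blinfun.bounded_linear_right)

lemma bop_eqI: "(\<And>x. S \<bullet>\<^sub>v x = T \<bullet>\<^sub>v x) \<Longrightarrow> S = T"
  by transfer (rule blinfun_eqI)

lemma bop_eqI_basis:
  fixes S T :: "'a bop"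
  assumes "\<And>i. S \<bullet>\<^sub>v ell2_basis i = T \<bullet>\<^sub>v ell2_basis i"
  shows "S = T"
proof (rule bop_eqI)
  fix x
  have "((\<lambda>i. R \<bullet>\<^sub>v (ell2_apply x i *\<^sub>C ell2_basis i)) has_sum (R \<bullet>\<^sub>v x)) UNIV" for R :: "'a bop"
    using has_sum_bounded_linear[OF bounded_linear_bop_apply ell2_has_sum_basis] by (simp add: o_def)
  from this[of S] this[of T] show "S \<bullet>\<^sub>v x = T \<bullet>\<^sub>v x" by (simp add: assms has_sum_unique)
qed

lemma scaleC_zero_right [simp]: "c *\<^sub>C (0 :: 'a::complex_vector) = 0"
  using scaleC_add_right[of c 0 0] by simp

lemma scaleC_minus_right: "c *\<^sub>C (- x) = - (c *\<^sub>C (x :: 'a::complex_vector))"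
  using scaleC_add_right[of c x "- x"] by (simp add: eq_neg_iff_add_eq_0 add.commute)

lemma scaleC_diff_right: "c *\<^sub>C (x - y) = c *\<^sub>C x - c *\<^sub>C (y :: 'a::complex_vector)"
  using scaleC_add_right[of c x "- y"] by (simp add: scaleC_minus_right)

lemma bounded_linear_scaleC: "bounded_linear ((*\<^sub>C) c :: 'a::complex_normed_vector \<Rightarrow> 'a)"
  by (rule bounded_linear_intro[where K = "cmod c"])
    (simp_all add: scaleC_add_right scaleR_scaleC mult.commute)

instantiation bop :: (type) complex_vector
begin
lift_definition zero_bop :: "'a bop" is 0 by simp
lift_definition plus_bop :: "'a bop \<Rightarrow> 'a bop \<Rightarrow> 'a bop" is "(+)"
  by (simp add: blinfun.add_left scaleC_add_right)
lift_definition uminus_bop :: "'a bop \<Rightarrow> 'a bop" is uminus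
  by (simp add: blinfun.minus_left scaleC_minus_right)
lift_definition minus_bop :: "'a bop \<Rightarrow> 'a bop \<Rightarrow> 'a bop" is "(-)"
  by (simp add: blinfun.diff_left scaleC_diff_right)
lift_definition scaleC_bop :: "complex \<Rightarrow> 'a bop \<Rightarrow> 'a bop"
  is "\<lambda>c T. Blinfun ((*\<^sub>C) c) o\<^sub>L T"
  by (simp add: bounded_linear_Blinfun_apply bounded_linear_scaleC mult.commute)
lift_definition scaleR_bop :: "real \<Rightarrow> 'a bop \<Rightarrow> 'a bop" is "(*\<^sub>R)"
  by (simp add: blinfun.scaleR_left scaleR_scaleC mult.commute)
instance
  by standard (transfer, auto intro!: blinfun_eqI simp: bounded_linear_Blinfun_apply
      bounded_linear_scaleC scaleR_scaleC blinfun.add_left blinfun.scaleR_left blinfun.diff_left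
      blinfun.minus_left scaleC_add_left scaleC_add_right)+
end

lemma bop_add_apply: "(S + T) \<bullet>\<^sub>v x = S \<bullet>\<^sub>v x + T \<bullet>\<^sub>v x"
  by transfer (simp add: blinfun.add_left)

lemma bop_scaleC_apply: "(c *\<^sub>C T) \<bullet>\<^sub>v x = c *\<^sub>C (T \<bullet>\<^sub>v x)"
  by transfer (simp add: bounded_linear_Blinfun_apply bounded_linear_scaleC)

instantiation bop :: (type) real_normed_vector
begin
lift_definition norm_bop :: "'a bop \<Rightarrow> real" is norm .
definition sgn_bop :: "'a bop \<Rightarrow> 'a bop" where "sgn_bop x = inverse (norm x) *\<^sub>R x"
definition dist_bop :: "'a bop \<Rightarrow> 'a bop \<Rightarrow> real" where "dist_bop x y = norm (x - y)"
definition uniformity_bop :: "('a bop \<times> 'a bop) filter"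
  where "uniformity_bop = (INF e\<in>{0<..}. principal {(x, y). dist x y < e})"
definition open_bop :: "'a bop set \<Rightarrow> bool"
  where "open_bop U \<longleftrightarrow> (\<forall>x\<in>U. \<forall>\<^sub>F (x', y) in uniformity. x' = x \<longrightarrow> y \<in> U)"
instance
proof
  fix x y :: "'a bop" and a b :: real
  show "a *\<^sub>R (x + y) = a *\<^sub>R x + a *\<^sub>R y" by transfer (rule scaleR_add_right)
  show "(a + b) *\<^sub>R x = a *\<^sub>R x + b *\<^sub>R x" by transfer (rule scaleR_add_left)
  show "a *\<^sub>R b *\<^sub>R x = (a * b) *\<^sub>R x" by transfer simp
  show "1 *\<^sub>R x = x" by transfer simp
  show "norm x = 0 \<longleftrightarrow> x = 0" by transfer simp
  show "norm (x + y) \<le> norm x + norm y" by transfer (rule norm_triangle_ineq)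
  show "norm (a *\<^sub>R x) = \<bar>a\<bar> * norm x" by transfer simp
qed (simp_all add: sgn_bop_def dist_bop_def uniformity_bop_def open_bop_def)
end

lemma norm_bop_apply_le: "norm (T \<bullet>\<^sub>v x) \<le> norm T * norm x"
  by transfer (rule norm_blinfun)

lemma norm_bop_bound: "0 \<le> B \<Longrightarrow> (\<And>x. norm (T \<bullet>\<^sub>v x) \<le> B * norm x) \<Longrightarrow> norm T \<le> B"
  by transfer (rule norm_blinfun_bound)

lemma bop_exI:
  assumes "\<And>x y. f (x + y) = f x + f y" "\<And>c x. f (c *\<^sub>C x) = c *\<^sub>C f x"
    and "\<And>x. norm (f x) \<le> K * norm x"
  shows "\<exists>T. \<forall>x. T \<bullet>\<^sub>v x = f x"
proof -
  have "bounded_linear f"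
    by (rule bounded_linear_intro[where K = K]) (simp_all add: assms scaleR_scaleC mult.commute)
  then show ?thesis
    by (intro exI[of _ "Abs_bop (Blinfun f)"])
      (simp add: bop_apply.rep_eq Abs_bop_inverse bounded_linear_Blinfun_apply assms)
qed

instance bop :: (type) complex_normed_vector
proof
  fix a :: complex and T :: "'a bop"
  have le: "norm (a *\<^sub>C T) \<le> cmod a * norm T" for a and T :: "'a bop"
    by (rule norm_bop_bound)
      (auto simp: bop_scaleC_apply mult.assoc intro!: mult_left_mono norm_bop_apply_le)
  show "norm (a *\<^sub>C T) = cmod a * norm T"
  proof (cases "a = 0")
    case True
    then show ?thesis using le[of a T] by simp
  next
    case False
    with le[of "inverse a" "a *\<^sub>C T"] have "cmod a * norm T \<le> norm (a *\<^sub>C T)"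
      by (simp add: norm_inverse field_simps norm_divide)
    with le[of a T] show ?thesis by simp
  qed
qed

instance bop :: (type) banach
proof
  fix X :: "nat \<Rightarrow> 'a bop"
  assume X: "Cauchy X"
  have "Cauchy (\<lambda>n. blinfun_of_bop (X n))"
    using X unfolding Cauchy_def dist_norm by (simp flip: minus_bop.rep_eq norm_bop.rep_eq)
  then obtain L where L: "(\<lambda>n. blinfun_of_bop (X n)) \<longlonglongrightarrow> L"
    by (auto simp: Cauchy_convergent_iff convergent_def)
  have ap: "(\<lambda>n. blinfun_of_bop (X n) x) \<longlonglongrightarrow> L x" for x
    by (intro tendsto_intros L)
  have "L (c *\<^sub>C x) = c *\<^sub>C L x" for c x
  proof (rule LIMSEQ_unique)
    show "(\<lambda>n. blinfun_of_bop (X n) (c *\<^sub>C x)) \<longlonglongrightarrow> L (c *\<^sub>C x)" by (rule ap)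
    show "(\<lambda>n. blinfun_of_bop (X n) (c *\<^sub>C x)) \<longlonglongrightarrow> c *\<^sub>C L x"
      using bounded_linear.tendsto[OF bounded_linear_scaleC ap, of c x] blinfun_of_bop[of "X n" for n]
      by simp
  qed
  then have "blinfun_of_bop (Abs_bop L) = L" by (simp add: Abs_bop_inverse)
  with L have "X \<longlonglongrightarrow> Abs_bop L"
    unfolding LIMSEQ_iff by (simp add: norm_bop.rep_eq minus_bop.rep_eq)
  then show "convergent X" by (auto simp: convergent_def)
qed

lemma bop_adjoint_exists:
  "\<exists>S. (\<forall>x y. cinner (T \<bullet>\<^sub>v x) y = cinner x (S \<bullet>\<^sub>v y)) \<and> norm S \<le> norm T"
proof -
  define g where "g y i = cinner (T \<bullet>\<^sub>v ell2_basis i) y" for y i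
  have bd: "(\<Sum>i\<in>F. (cmod (g y i))\<^sup>2) \<le> (norm T * norm y)\<^sup>2" if F: "finite F" for y F
  proof -
    define v where "v = (\<Sum>i\<in>F. g y i *\<^sub>C ell2_basis i)"
    define s where "s = (\<Sum>i\<in>F. (cmod (g y i))\<^sup>2)"
    have "s \<ge> 0" by (simp add: s_def sum_nonneg)
    have vj: "ell2_apply v j = (if j \<in> F then g y j else 0)" for j
      using F by (simp add: v_def ell2_apply_sum scaleC_ell2.rep_eq ell2_basis.rep_eq of_bool_def
          if_distrib cong: if_cong)
    have "(norm v)\<^sup>2 = (\<Sum>\<^sub>\<infinity>j\<in>F. (cmod (g y j))\<^sup>2)"
      unfolding norm_ell2_square by (rule infsum_cong_neutral) (auto simp: vj)
    then have nv: "norm v = sqrt s" using F by (simp add: s_def real_sqrt_unique)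
    have "T \<bullet>\<^sub>v v = (\<Sum>i\<in>F. g y i *\<^sub>C (T \<bullet>\<^sub>v ell2_basis i))"
      unfolding v_def linear_sum[OF bounded_linear.linear[OF bounded_linear_bop_apply]] by simp
    then have "cinner y (T \<bullet>\<^sub>v v) = (\<Sum>i\<in>F. g y i * cinner y (T \<bullet>\<^sub>v ell2_basis i))"
      by (simp add: linear_sum[OF bounded_linear.linear[OF bounded_linear_cinner_right]])
    also have "\<dots> = (\<Sum>i\<in>F. complex_of_real ((cmod (g y i))\<^sup>2))"
      by (intro sum.cong refl) (simp only: complex_norm_square g_def cinner_commute)
    finally have "cinner y (T \<bullet>\<^sub>v v) = complex_of_real s" by (simp add: s_def)
    then have "s \<le> norm y * norm (T \<bullet>\<^sub>v v)"
      using cmod_cinner_le[of y "T \<bullet>\<^sub>v v"] \<open>s \<ge> 0\<close> by simp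
    also have "\<dots> \<le> norm y * (norm T * sqrt s)"
      using norm_bop_apply_le[of T v] by (intro mult_left_mono) (simp_all add: nv)
    finally have "sqrt s * sqrt s \<le> (norm T * norm y) * sqrt s" using \<open>s \<ge> 0\<close> by (simp add: mult_ac)
    then have "sqrt s \<le> norm T * norm y"
      by (cases "s = 0") (use \<open>s \<ge> 0\<close> in \<open>auto simp del: real_sqrt_mult_self simp: mult_le_cancel_right\<close>)
    then show ?thesis
      unfolding s_def[symmetric] using \<open>s \<ge> 0\<close> by (metis real_sqrt_ge_zero power_mono real_sqrt_pow2)
  qed
  define f where "f y = Abs_ell2 (g y)" for y
  have f: "ell2_apply (f y) = g y" for y
    unfolding f_def using ell2_boundedI(1)[OF bd] by (simp add: Abs_ell2_inverse)
  have adj: "cinner (T \<bullet>\<^sub>v x) y = cinner x (f y)" for x y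
  proof -
    have "((\<lambda>i. cinner y (T \<bullet>\<^sub>v (ell2_apply x i *\<^sub>C ell2_basis i))) has_sum cinner y (T \<bullet>\<^sub>v x)) UNIV"
      using has_sum_bounded_linear[OF bounded_linear_compose[OF bounded_linear_cinner_right
            bounded_linear_bop_apply] ell2_has_sum_basis] by (simp add: o_def)
    moreover have "((\<lambda>i. cinner (f y) (ell2_apply x i *\<^sub>C ell2_basis i)) has_sum cinner (f y) x) UNIV"
      using has_sum_bounded_linear[OF bounded_linear_cinner_right ell2_has_sum_basis]
      by (simp add: o_def)
    moreover have "cinner (f y) (ell2_basis i) = cinner y (T \<bullet>\<^sub>v ell2_basis i)" for i
      by (metis cinner_basis_left cinner_commute f g_def)
    ultimately have "cinner y (T \<bullet>\<^sub>v x) = cinner (f y) x" by (simp add: has_sum_unique)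
    then show ?thesis by (metis cinner_commute)
  qed
  have nf: "norm (f y) \<le> norm T * norm y" for y
  proof -
    have "(norm (f y))\<^sup>2 \<le> (norm T * norm y)\<^sup>2"
      unfolding norm_ell2_square f by (rule ell2_boundedI(2)[OF bd])
    then show ?thesis by (rule power2_le_imp_le) simp
  qed
  have "\<exists>S. \<forall>y. S \<bullet>\<^sub>v y = f y"
    by (rule bop_exI[OF _ _ nf]; rule cinner_eqI)
      (simp_all add: cinner_add_right flip: adj)
  then obtain S where "\<And>y. S \<bullet>\<^sub>v y = f y" by blast
  then show ?thesis using adj nf by (metis norm_bop_bound norm_ge_zero)
qed

instantiation bop :: (type) cstar_algebra
begin
lift_definition one_bop :: "'a bop" is id_blinfun by simp
lift_definition times_bop :: "'a bop \<Rightarrow> 'a bop \<Rightarrow> 'a bop" is "(o\<^sub>L)" by simp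
definition star_bop :: "'a bop \<Rightarrow> 'a bop" where
  "star_bop T = (THE S. \<forall>x y. cinner (T \<bullet>\<^sub>v x) y = cinner x (S \<bullet>\<^sub>v y))"

lemma bop_times_apply: "(S * T) \<bullet>\<^sub>v x = S \<bullet>\<^sub>v (T \<bullet>\<^sub>v x)" for S :: "'a bop"
  by transfer simp

lemma bop_one_apply: "(1 :: 'a bop) \<bullet>\<^sub>v x = x"
  by transfer simp

lemma bop_starI:
  assumes "\<And>x y. cinner (T \<bullet>\<^sub>v x) y = cinner x (S \<bullet>\<^sub>v y)"
  shows "T\<^sup>\<star> = (S :: 'a bop)"
  unfolding star_bop_def
proof (rule the_equality)
  fix R assume R: "\<forall>x y. cinner (T \<bullet>\<^sub>v x) y = cinner x (R \<bullet>\<^sub>v y)"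
  show "R = S" by (intro bop_eqI cinner_eqI) (metis R assms)
qed (use assms in blast)

lemma
  fixes T :: "'a bop"
  shows cinner_star: "cinner (T \<bullet>\<^sub>v x) y = cinner x (T\<^sup>\<star> \<bullet>\<^sub>v y)"
    and norm_star_le: "norm (T\<^sup>\<star>) \<le> norm T"
  using bop_adjoint_exists[of T] bop_starI by metis+

lemma cinner_star': "cinner (T\<^sup>\<star> \<bullet>\<^sub>v x) y = cinner x (T \<bullet>\<^sub>v y)" for T :: "'a bop"
  by (metis cinner_star cinner_commute)

instance
proof
  fix S T R :: "'a bop" and a :: complex and r :: real
  show "(S * T) * R = S * (T * R)" "1 * S = S" "S * 1 = S" "(S + T) * R = S * R + T * R"
    by (auto intro!: bop_eqI simp: bop_times_apply bop_one_apply bop_add_apply)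
  show "S * (T + R) = S * T + S * R"
    by (auto intro!: bop_eqI simp: bop_times_apply bop_add_apply
        linear_add[OF bounded_linear.linear[OF bounded_linear_bop_apply]])
  have scL: "(a *\<^sub>C S) * T = a *\<^sub>C (S * T)" and scR: "S * (a *\<^sub>C T) = a *\<^sub>C (S * T)"
    for a and S T :: "'a bop"
    by (auto intro!: bop_eqI simp: bop_times_apply bop_scaleC_apply)
  then show "(a *\<^sub>C S) * T = a *\<^sub>C (S * T)" "S * (a *\<^sub>C T) = a *\<^sub>C (S * T)"
    "(r *\<^sub>R S) * T = r *\<^sub>R (S * T)" "S * (r *\<^sub>R T) = r *\<^sub>R (S * T)"
    by (simp_all add: scaleR_scaleC)
  show mult: "norm (S * T) \<le> norm S * norm T" for S T :: "'a bop"
    by transfer (rule norm_blinfun_compose)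
  let ?e = "ell2_basis undefined :: 'a ell2"
  have "norm (1 :: 'a bop) \<le> 1" by (rule norm_bop_bound) (simp_all add: bop_one_apply)
  moreover have "1 \<le> norm (1 :: 'a bop)" using norm_bop_apply_le[of 1 ?e] by (simp add: bop_one_apply)
  ultimately show n1: "norm (1 :: 'a bop) = 1" by simp
  show "(0 :: 'a bop) \<noteq> 1" using n1 norm_zero by (metis zero_neq_one)
  show "(S\<^sup>\<star>)\<^sup>\<star> = S" by (rule bop_starI) (simp add: cinner_star')
  show "(S + T)\<^sup>\<star> = S\<^sup>\<star> + T\<^sup>\<star>"
    by (rule bop_starI) (simp add: bop_add_apply cinner_add_left cinner_add_right cinner_star)
  show "(a *\<^sub>C S)\<^sup>\<star> = cnj a *\<^sub>C S\<^sup>\<star>"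
    by (rule bop_starI) (simp add: bop_scaleC_apply cinner_star)
  show "(S * T)\<^sup>\<star> = T\<^sup>\<star> * S\<^sup>\<star>"
    by (rule bop_starI) (simp add: bop_times_apply cinner_star)
  show "norm (S\<^sup>\<star> * S) = (norm S)\<^sup>2"
  proof (rule antisym)
    show "norm (S\<^sup>\<star> * S) \<le> (norm S)\<^sup>2"
      using mult[of "S\<^sup>\<star>" S] mult_right_mono[OF norm_star_le[of S], of "norm S"]
      by (simp add: power2_eq_square)
    have "norm S \<le> sqrt (norm (S\<^sup>\<star> * S))"
    proof (rule norm_bop_bound)
      fix x
      have "complex_of_real ((norm (S \<bullet>\<^sub>v x))\<^sup>2) = cinner x ((S\<^sup>\<star> * S) \<bullet>\<^sub>v x)"
        by (simp only: cinner_self_norm[symmetric] cinner_star bop_times_apply)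
      then have "(norm (S \<bullet>\<^sub>v x))\<^sup>2 \<le> norm x * norm ((S\<^sup>\<star> * S) \<bullet>\<^sub>v x)"
        by (metis cmod_cinner_le norm_of_real abs_of_nonneg zero_le_power2)
      also have "\<dots> \<le> norm x * (norm (S\<^sup>\<star> * S) * norm x)"
        by (intro mult_left_mono norm_bop_apply_le) simp
      also have "\<dots> = (sqrt (norm (S\<^sup>\<star> * S)) * norm x)\<^sup>2"
        by (simp add: power_mult_distrib) (simp add: power2_eq_square)
      finally show "norm (S \<bullet>\<^sub>v x) \<le> sqrt (norm (S\<^sup>\<star> * S)) * norm x"
        by (rule power2_le_imp_le) simp
    qed simp
    then have "(norm S)\<^sup>2 \<le> (sqrt (norm (S\<^sup>\<star> * S)))\<^sup>2" by (intro power_mono) auto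
    then show "(norm S)\<^sup>2 \<le> norm (S\<^sup>\<star> * S)" by simp
  qed
qed
end

text \<open>\<open>op_tensor S T\<close> is the operator \<open>S \<otimes> T\<close> on \<open>\<ell>\<^sup>2(I) \<otimes> \<ell>\<^sup>2(J) = \<ell>\<^sup>2(I \<times> J)\<close>.\<close>

definition op_tensor :: "'i bop \<Rightarrow> 'j bop \<Rightarrow> ('i \<times> 'j) bop" where
  "op_tensor S T = (THE W. \<forall>\<xi> \<eta>. W \<bullet>\<^sub>v (\<xi> \<otimes>\<^sub>h \<eta>) = (S \<bullet>\<^sub>v \<xi>) \<otimes>\<^sub>h (T \<bullet>\<^sub>v \<eta>))"

lemma bop_amplification_exists:
  fixes e :: "'i \<times> 'j \<Rightarrow> 'k" and R :: "'j bop"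
  assumes e: "bij e"
  shows "\<exists>W :: 'k bop. \<forall>\<psi> \<eta> i. (\<forall>j. ell2_apply \<psi> (e (i, j)) = ell2_apply \<eta> j) \<longrightarrow>
    (\<forall>j. ell2_apply (W \<bullet>\<^sub>v \<psi>) (e (i, j)) = ell2_apply (R \<bullet>\<^sub>v \<eta>) j)"
proof -
  define sl where "sl \<psi> i = Abs_ell2 (\<lambda>j. ell2_apply \<psi> (e (i, j)))" for \<psi> :: "'k ell2" and i
  have sm: "(\<lambda>p. (cmod (ell2_apply \<psi> (e p)))\<^sup>2) summable_on A" for \<psi> :: "'k ell2" and A
  proof -
    have "(\<lambda>p. (cmod (ell2_apply \<psi> (e p)))\<^sup>2) summable_on UNIV"
      using ell2_apply[of \<psi>] e by (simp add: summable_on_reindex_bij_betw[of e UNIV UNIV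
          "\<lambda>k. (cmod (ell2_apply \<psi> k))\<^sup>2"])
    then show ?thesis by (rule summable_on_subset_banach) simp
  qed
  have nrm: "(norm \<psi>)\<^sup>2 = (\<Sum>\<^sub>\<infinity>p. (cmod (ell2_apply \<psi> (e p)))\<^sup>2)" for \<psi> :: "'k ell2"
    unfolding norm_ell2_square using e
    by (simp add: infsum_reindex_bij_betw[of e UNIV UNIV "\<lambda>k. (cmod (ell2_apply \<psi> k))\<^sup>2"])
  have sl: "ell2_apply (sl \<psi> i) j = ell2_apply \<psi> (e (i, j))" for \<psi> i j
  proof -
    have "(\<lambda>j. (cmod (ell2_apply \<psi> (e (i, j))))\<^sup>2) summable_on UNIV"
      using sm[of \<psi> "Pair i ` UNIV"] by (subst (asm) summable_on_reindex) (simp_all add: o_def inj_on_def)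
    then show ?thesis by (simp add: sl_def Abs_ell2_inverse)
  qed
  have slsum: "(\<Sum>i\<in>A. (norm (sl \<psi> i))\<^sup>2) \<le> (norm \<psi>)\<^sup>2" if "finite A" for A and \<psi> :: "'k ell2"
  proof -
    have "(\<Sum>i\<in>A. (norm (sl \<psi> i))\<^sup>2) =
        (\<Sum>\<^sub>\<infinity>i\<in>A. \<Sum>\<^sub>\<infinity>j\<in>UNIV. (cmod (ell2_apply \<psi> (e (i, j))))\<^sup>2)"
      using that by (simp add: norm_ell2_square sl)
    also have "\<dots> = (\<Sum>\<^sub>\<infinity>(i, j)\<in>A \<times> UNIV. (cmod (ell2_apply \<psi> (e (i, j))))\<^sup>2)"
      by (rule infsum_Sigma'_banach) (use sm[of \<psi> "A \<times> UNIV"] in \<open>simp add: case_prod_unfold\<close>)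
    also have "\<dots> \<le> (norm \<psi>)\<^sup>2"
      unfolding nrm by (rule infsum_mono_neutral) (use sm in \<open>auto simp: case_prod_unfold\<close>)
    finally show ?thesis .
  qed
  define f where "f \<psi> k = (case inv e k of (i, j) \<Rightarrow> ell2_apply (R \<bullet>\<^sub>v sl \<psi> i) j)"
    for \<psi> :: "'k ell2" and k
  have fe: "f \<psi> (e (i, j)) = ell2_apply (R \<bullet>\<^sub>v sl \<psi> i) j" for \<psi> i j
    using e by (simp add: f_def bij_is_inj inv_f_f)
  have bd: "(\<Sum>k\<in>F. (cmod (f \<psi> k))\<^sup>2) \<le> (norm R * norm \<psi>)\<^sup>2" if F: "finite F" for F \<psi>
  proof -
    define G where "G = inv e ` F"
    have FG: "F = e ` G" "finite G" using e F by (simp_all add: G_def image_f_inv_f bij_is_surj)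
    have "(\<Sum>k\<in>F. (cmod (f \<psi> k))\<^sup>2) = (\<Sum>p\<in>G. (cmod (f \<psi> (e p)))\<^sup>2)"
      unfolding FG(1) using e by (subst sum.reindex) (auto intro: inj_on_subset bij_is_inj)
    also have "\<dots> \<le> (\<Sum>p\<in>fst ` G \<times> snd ` G. (cmod (f \<psi> (e p)))\<^sup>2)"
      using FG by (intro sum_mono2) force+
    also have "\<dots> = (\<Sum>i\<in>fst ` G. \<Sum>j\<in>snd ` G. (cmod (ell2_apply (R \<bullet>\<^sub>v sl \<psi> i) j))\<^sup>2)"
      unfolding sum.cartesian_product by (intro sum.cong refl) (auto simp: fe)
    also have "\<dots> \<le> (\<Sum>i\<in>fst ` G. (norm (R \<bullet>\<^sub>v sl \<psi> i))\<^sup>2)"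
      using FG by (intro sum_mono sum_le_norm_ell2) simp
    also have "\<dots> \<le> (\<Sum>i\<in>fst ` G. (norm R * norm (sl \<psi> i))\<^sup>2)"
      by (intro sum_mono power_mono norm_bop_apply_le) simp
    also have "\<dots> = (norm R)\<^sup>2 * (\<Sum>i\<in>fst ` G. (norm (sl \<psi> i))\<^sup>2)"
      by (simp add: power_mult_distrib sum_distrib_left)
    also have "\<dots> \<le> (norm R)\<^sup>2 * (norm \<psi>)\<^sup>2"
      using FG by (intro mult_left_mono slsum) auto
    finally show ?thesis by (simp add: power_mult_distrib)
  qed
  define g where "g \<psi> = Abs_ell2 (f \<psi>)" for \<psi>
  have g: "ell2_apply (g \<psi>) = f \<psi>" for \<psi>
    unfolding g_def using ell2_boundedI(1)[OF bd] by (simp add: Abs_ell2_inverse)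
  have g_eqI: "\<psi> = \<phi>" if "\<And>i j. ell2_apply \<psi> (e (i, j)) = ell2_apply \<phi> (e (i, j))"
    for \<psi> \<phi> :: "'k ell2"
    using e that by (metis ell2_apply_inject ext bij_pointE surj_pair)
  have sl_add: "sl (\<psi> + \<phi>) i = sl \<psi> i + sl \<phi> i" and sl_sc: "sl (c *\<^sub>C \<psi>) i = c *\<^sub>C sl \<psi> i"
    for \<psi> \<phi> i c
    by (rule iffD1[OF ell2_apply_inject], simp add: fun_eq_iff sl plus_ell2.rep_eq scaleC_ell2.rep_eq)+
  have "\<exists>W. \<forall>\<psi>. W \<bullet>\<^sub>v \<psi> = g \<psi>"
  proof (rule bop_exI)
    fix \<psi> \<phi> :: "'k ell2" and c
    show "g (\<psi> + \<phi>) = g \<psi> + g \<phi>"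
      by (rule g_eqI) (simp add: g fe sl_add plus_ell2.rep_eq
          linear_add[OF bounded_linear.linear[OF bounded_linear_bop_apply]])
    show "g (c *\<^sub>C \<psi>) = c *\<^sub>C g \<psi>"
      by (rule g_eqI) (simp add: g fe sl_sc scaleC_ell2.rep_eq)
    have "(norm (g \<psi>))\<^sup>2 \<le> (norm R * norm \<psi>)\<^sup>2"
      unfolding norm_ell2_square g by (rule ell2_boundedI(2)[OF bd])
    then show "norm (g \<psi>) \<le> norm R * norm \<psi>" by (rule power2_le_imp_le) simp
  qed
  then obtain W where W: "\<And>\<psi>. W \<bullet>\<^sub>v \<psi> = g \<psi>" by blast
  show ?thesis
  proof (intro exI[of _ W] allI impI)
    fix \<psi> \<eta> i j
    assume "\<forall>j. ell2_apply \<psi> (e (i, j)) = ell2_apply \<eta> j"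
    then have "sl \<psi> i = \<eta>" by (intro iffD1[OF ell2_apply_inject] ext) (simp add: sl)
    then show "ell2_apply (W \<bullet>\<^sub>v \<psi>) (e (i, j)) = ell2_apply (R \<bullet>\<^sub>v \<eta>) j" by (simp add: W g fe)
  qed
qed

lemma bop_eqI_tensor:
  fixes V W :: "('i \<times> 'j) bop"
  assumes "\<And>\<xi> \<eta>. V \<bullet>\<^sub>v (\<xi> \<otimes>\<^sub>h \<eta>) = W \<bullet>\<^sub>v (\<xi> \<otimes>\<^sub>h \<eta>)"
  shows "V = W"
  by (rule bop_eqI_basis) (metis assms ell2_basis_pair surj_pair)

lemma op_tensor_apply: "op_tensor S T \<bullet>\<^sub>v (\<xi> \<otimes>\<^sub>h \<eta>) = (S \<bullet>\<^sub>v \<xi>) \<otimes>\<^sub>h (T \<bullet>\<^sub>v \<eta>)"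
  for S :: "'i bop" and T :: "'j bop"
proof -
  obtain W2 :: "('i \<times> 'j) bop" where W2: "\<And>\<psi> \<eta> i j. (\<And>j. ell2_apply \<psi> (i, j) = ell2_apply \<eta> j) \<Longrightarrow>
      ell2_apply (W2 \<bullet>\<^sub>v \<psi>) (i, j) = ell2_apply (T \<bullet>\<^sub>v \<eta>) j"
    using bop_amplification_exists[of "id :: 'i \<times> 'j \<Rightarrow> _" T] by (simp add: bij_id) metis
  obtain W1 :: "('i \<times> 'j) bop" where W1: "\<And>\<psi> \<xi> i j. (\<And>i. ell2_apply \<psi> (i, j) = ell2_apply \<xi> i) \<Longrightarrow>
      ell2_apply (W1 \<bullet>\<^sub>v \<psi>) (i, j) = ell2_apply (S \<bullet>\<^sub>v \<xi>) i"
    using bop_amplification_exists[of "prod.swap :: 'j \<times> 'i \<Rightarrow> _" S] by simp metis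
  have "ell2_apply (W2 \<bullet>\<^sub>v (\<xi> \<otimes>\<^sub>h \<eta>)) (i, j) = ell2_apply (T \<bullet>\<^sub>v (ell2_apply \<xi> i *\<^sub>C \<eta>)) j" for \<xi> \<eta> i j
    by (rule W2) (simp add: ell2_tensor.rep_eq scaleC_ell2.rep_eq)
  then have "W2 \<bullet>\<^sub>v (\<xi> \<otimes>\<^sub>h \<eta>) = \<xi> \<otimes>\<^sub>h (T \<bullet>\<^sub>v \<eta>)" for \<xi> \<eta>
    by (intro iffD1[OF ell2_apply_inject] ext) (auto simp: ell2_tensor.rep_eq scaleC_ell2.rep_eq)
  moreover
  have "ell2_apply (W1 \<bullet>\<^sub>v (\<xi> \<otimes>\<^sub>h \<eta>)) (i, j) = ell2_apply (S \<bullet>\<^sub>v (ell2_apply \<eta> j *\<^sub>C \<xi>)) i" for \<xi> \<eta> i j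
    by (rule W1) (simp add: ell2_tensor.rep_eq scaleC_ell2.rep_eq)
  then have "W1 \<bullet>\<^sub>v (\<xi> \<otimes>\<^sub>h \<eta>) = (S \<bullet>\<^sub>v \<xi>) \<otimes>\<^sub>h \<eta>" for \<xi> \<eta>
    by (intro iffD1[OF ell2_apply_inject] ext) (auto simp: ell2_tensor.rep_eq scaleC_ell2.rep_eq)
  ultimately have "\<forall>\<xi> \<eta>. (W1 * W2) \<bullet>\<^sub>v (\<xi> \<otimes>\<^sub>h \<eta>) = (S \<bullet>\<^sub>v \<xi>) \<otimes>\<^sub>h (T \<bullet>\<^sub>v \<eta>)"
    by (simp add: bop_times_apply)
  then have "\<exists>!W. \<forall>\<xi> \<eta>. W \<bullet>\<^sub>v (\<xi> \<otimes>\<^sub>h \<eta>) = (S \<bullet>\<^sub>v \<xi>) \<otimes>\<^sub>h (T \<bullet>\<^sub>v \<eta>)"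
    by (intro ex_ex1I exI[of _ "W1 * W2"]) (auto intro: bop_eqI_tensor)
  from theI'[OF this] show ?thesis unfolding op_tensor_def by blast
qed


section \<open>Tensor products of C*-algebras\<close>

definition cbilinear ::
  "('a::complex_vector \<Rightarrow> 'b::complex_vector \<Rightarrow> 'c::complex_vector) \<Rightarrow> bool"
  where "cbilinear f \<longleftrightarrow> (\<forall>x. clinear (f x)) \<and> (\<forall>y. clinear (\<lambda>x. f x y))"

text \<open>
  The list \<open>[(x\<^sub>1, y\<^sub>1), \<dots>, (x\<^sub>n, y\<^sub>n)]\<close> stands for the finite sum of the \<open>x\<^sub>i \<otimes> y\<^sub>i\<close>;
  concatenation of lists is addition.
\<close>

inductive tensor_eq ::
  "('a::complex_vector \<times> 'b::complex_vector) list \<Rightarrow> ('a \<times> 'b) list \<Rightarrow> bool" where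
  refl: "tensor_eq t t"
| sym: "tensor_eq s t \<Longrightarrow> tensor_eq t s"
| trans: "tensor_eq s t \<Longrightarrow> tensor_eq t u \<Longrightarrow> tensor_eq s u"
| append: "tensor_eq s s' \<Longrightarrow> tensor_eq t t' \<Longrightarrow> tensor_eq (s @ t) (s' @ t')"
| commute: "tensor_eq (s @ t) (t @ s)"
| zero: "tensor_eq [(0, 0)] []"
| add_left: "tensor_eq [(x + x', y)] [(x, y), (x', y)]"
| add_right: "tensor_eq [(x, y + y')] [(x, y), (x, y')]"
| scale: "tensor_eq [(c *\<^sub>C x, y)] [(x, c *\<^sub>C y)]"

quotient_type (overloaded) ('a, 'b) alg_tensor =
  "('a::complex_vector \<times> 'b::complex_vector) list" / tensor_eq
  by (auto intro!: equivpI reflpI sympI transpI intro: tensor_eq.intros)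

lemma tensor_eq_lift:
  assumes "tensor_eq s t" "cbilinear f"
  shows "(\<Sum>(x, y)\<leftarrow>s. f x y) = (\<Sum>(x, y)\<leftarrow>t. f x y)"
  using assms
proof (induction rule: tensor_eq.induct)
  case zero
  then have "f 0 0 + f 0 0 = f 0 0" by (metis cbilinear_def clinear_def add.right_neutral)
  then show ?case by simp
qed (simp_all add: cbilinear_def clinear_def add.commute)

text \<open>The linear map with \<open>x \<otimes> y \<mapsto> f x y\<close>, for bilinear \<open>f\<close>.\<close>

lift_definition tensor_lift ::
  "('a::complex_vector \<Rightarrow> 'b::complex_vector \<Rightarrow> 'c::complex_vector) \<Rightarrow> ('a, 'b) alg_tensor \<Rightarrow> 'c"
  is "\<lambda>f t. if cbilinear f then \<Sum>(x, y)\<leftarrow>t. f x y else 0"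
  by (simp add: tensor_eq_lift)

lemma cbilinear_op_tensor_hom:
  assumes "unital_star_hom \<pi>" "unital_star_hom \<rho>"
  shows "cbilinear (\<lambda>x a. op_tensor (\<pi> x) (\<rho> a))"
proof -
  have add: "\<xi> \<otimes>\<^sub>h (\<eta> + \<eta>') = \<xi> \<otimes>\<^sub>h \<eta> + \<xi> \<otimes>\<^sub>h \<eta>'" "(\<xi> + \<xi>') \<otimes>\<^sub>h \<eta> = \<xi> \<otimes>\<^sub>h \<eta> + \<xi>' \<otimes>\<^sub>h \<eta>"
    and sc: "\<xi> \<otimes>\<^sub>h (c *\<^sub>C \<eta>) = c *\<^sub>C (\<xi> \<otimes>\<^sub>h \<eta>)" "(c *\<^sub>C \<xi>) \<otimes>\<^sub>h \<eta> = c *\<^sub>C (\<xi> \<otimes>\<^sub>h \<eta>)"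
    for \<xi> \<xi>' :: "'i ell2" and \<eta> \<eta>' :: "'j ell2" and c
    by (rule iffD1[OF ell2_apply_inject],
        simp add: fun_eq_iff ell2_tensor.rep_eq plus_ell2.rep_eq scaleC_ell2.rep_eq algebra_simps)+
  show ?thesis
    using assms unfolding cbilinear_def clinear_def unital_star_hom_def
    by (auto intro!: bop_eqI_tensor simp: op_tensor_apply bop_add_apply bop_scaleC_apply add sc)
qed

text \<open>
  \<open>\<parallel>t\<parallel>\<^sub>m\<^sub>i\<^sub>n\<close> is the supremum of \<open>\<parallel>(\<pi> \<otimes> \<rho>)(t)\<parallel>\<close> over unital representations \<open>\<pi>\<close> of \<open>A\<close> and
  \<open>\<rho>\<close> of \<open>B\<close>, and \<open>\<parallel>t\<parallel>\<^sub>m\<^sub>a\<^sub>x\<close> is the supremum of \<open>\<parallel>(\<pi> \<cdot> \<rho>)(t)\<parallel>\<close> over pairs of unital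
  representations of \<open>A\<close> and \<open>B\<close> on one Hilbert space with commuting ranges, that is, over the
  unital representations of the *-algebra \<open>A \<odot> B\<close>. It is enough to represent on \<open>\<ell>\<^sup>2(A \<times> B)\<close>:
  the suprema are determined by the nonzero representations of \<open>A\<close>, \<open>B\<close> and \<open>A \<odot> B\<close> that are
  generated by finitely many vectors; these live on Hilbert spaces of dimension at most
  \<open>|A \<times> B|\<close>, and a direct sum of \<open>|A \<times> B|\<close> copies has dimension exactly \<open>|A \<times> B|\<close>.
  The C*-algebras \<open>A \<otimes>\<^sub>m\<^sub>i\<^sub>n B\<close> and \<open>A \<otimes>\<^sub>m\<^sub>a\<^sub>x B\<close> are the completions of \<open>A \<odot> B\<close> in these norms,
  so they coincide if and only if the norms do.
\<close>

definition min_tensor_norm :: "('a::cstar_algebra, 'b::cstar_algebra) alg_tensor \<Rightarrow> real" where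
  "min_tensor_norm t = Sup {norm (tensor_lift (\<lambda>x y. op_tensor (\<pi> x) (\<rho> y)) t) |
    (\<pi> :: 'a \<Rightarrow> ('a \<times> 'b) bop) (\<rho> :: 'b \<Rightarrow> ('a \<times> 'b) bop).
    unital_star_hom \<pi> \<and> unital_star_hom \<rho>}"

definition max_tensor_norm :: "('a::cstar_algebra, 'b::cstar_algebra) alg_tensor \<Rightarrow> real" where
  "max_tensor_norm t = Sup {norm (tensor_lift (\<lambda>x y. \<pi> x * \<rho> y) t) |
    (\<pi> :: 'a \<Rightarrow> ('a \<times> 'b) bop) (\<rho> :: 'b \<Rightarrow> ('a \<times> 'b) bop).
    unital_star_hom \<pi> \<and> unital_star_hom \<rho> \<and> (\<forall>x y. \<pi> x * \<rho> y = \<rho> y * \<pi> x)}"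


section \<open>The Cuntz algebra \<open>\<O>\<^sub>\<infinity>\<close>\<close>

definition cuntz_isometries :: "(nat \<Rightarrow> 'a::cstar_algebra) \<Rightarrow> bool" where
  "cuntz_isometries S \<longleftrightarrow> (\<forall>i. (S i)\<^sup>\<star> * S i = 1) \<and> (\<forall>k. (\<Sum>i<k. S i * (S i)\<^sup>\<star>) \<le>\<^sub>* 1)"

text \<open>
  The type \<open>'o\<close> is \<open>\<O>\<^sub>\<infinity>\<close> with canonical generators \<open>S\<close>. In the universal property it
  suffices to let the competing isometries \<open>T\<close> act on \<open>\<ell>\<^sup>2(\<nat>)\<close>: isometries in an arbitrary
  unital C*-algebra generate a separable one, which has a faithful unital representation there.
\<close>

definition is_cuntz_infinity :: "(nat \<Rightarrow> 'o::cstar_algebra) \<Rightarrow> bool" where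
  "is_cuntz_infinity S \<longleftrightarrow> cuntz_isometries S \<and> cstar_generated (range S) = UNIV \<and>
    (\<forall>T :: nat \<Rightarrow> nat bop. cuntz_isometries T \<longrightarrow>
      (\<exists>\<pi> :: 'o \<Rightarrow> nat bop. unital_star_hom \<pi> \<and> (\<forall>i. \<pi> (S i) = T i)))"

end

theory Submission
  imports Defs
begin

text \<open>
  For commuting representations \<open>\<pi>\<close> of \<open>\<O>\<^sub>\<infinity>\<close> and \<open>\<rho>\<close> of \<open>A\<close> on \<open>H\<close>, put \<open>T\<^sub>i = \<pi> (S\<^sub>i)\<close>. By universality
  there is a representation \<open>\<phi>\<close> of \<open>\<O>\<^sub>\<infinity>\<close> on some \<open>K\<close> with a unit vector \<open>\<omega>\<close> orthogonal to the ranges of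
  all \<open>\<phi> (S\<^sub>i)\<close>, as in the Fock representation. Copying \<open>h\<close> along the words \<open>v\<close> of length below \<open>n\<close>,
  as the sum of the \<open>\<phi> (S\<^sub>v) \<omega> \<otimes> c T\<^sub>v\<^sup>\<star> h\<close> with suitable weights \<open>c\<close>, gives a multiple by \<open>sqrt n\<close> of an
  isometry \<open>H \<rightarrow> K \<otimes> H\<close> which intertwines \<open>\<rho>\<close> with \<open>1 \<otimes> \<rho>\<close>, and \<open>T\<^sub>i\<close>, \<open>T\<^sub>i\<^sup>\<star>\<close> with \<open>\<phi> (S\<^sub>i) \<otimes> 1\<close>,
  \<open>\<phi> (S\<^sub>i)\<^sup>\<star> \<otimes> 1\<close> up to a bounded error. After normalisation the error vanishes as \<open>n \<rightarrow> \<infinity>\<close>, so \<open>\<pi> \<cdot> \<rho>\<close>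
  is asymptotically contained in \<open>\<phi> \<otimes> \<rho>\<close> and its norm is not larger. Conversely \<open>\<phi> \<otimes> \<rho>\<close> is itself a
  product of commuting representations.
\<close>

section \<open>Representations of C*-algebras on \<open>\<ell>\<^sup>2(I)\<close>\<close>

lemma norm_star [simp]: "norm (x\<^sup>\<star>) = norm x" for x :: "'a::cstar_algebra"
proof -
  have "norm y \<le> norm (y\<^sup>\<star>)" for y :: 'a
  proof (cases "y = 0")
    case False
    have "norm y * norm y \<le> norm (y\<^sup>\<star>) * norm y"
      using cstar_identity[of y] norm_mult_ineq[of "y\<^sup>\<star>" y] by (simp add: power2_eq_square)
    then show ?thesis using False by simp
  qed simp
  from this[of x] this[of "x\<^sup>\<star>"] show ?thesis by simp
qed

lemma bounded_linear_star: "bounded_linear (star :: 'a::cstar_algebra \<Rightarrow> 'a)"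
  by (rule bounded_linear_intro[where K = 1]) (simp_all add: star_add scaleR_scaleC star_scaleC)

lemmas star_sum = linear_sum[OF bounded_linear.linear[OF bounded_linear_star]]
lemmas star_diff = linear_diff[OF bounded_linear.linear[OF bounded_linear_star]]
lemmas star_scaleR = linear_cmul[OF bounded_linear.linear[OF bounded_linear_star]]
lemmas star_minus = linear_neg[OF bounded_linear.linear[OF bounded_linear_star]]

lemma star_one [simp]: "1\<^sup>\<star> = (1 :: 'a::cstar_algebra)"
  by (metis mult_1 mult_1_right star_mult star_star)

lemma star_power: "(x ^ n)\<^sup>\<star> = x\<^sup>\<star> ^ n" for x :: "'a::cstar_algebra"
  by (induction n) (simp_all add: star_mult power_commutes)

text \<open>Consecutive coefficients differ by the factor \<open>(1/2 - n) / Suc n\<close>, of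
  modulus at most 1. This lets a geometric series dominate the binomial series below.\<close>

lemma abs_half_gbinomial_le: "\<bar>(1/2 :: real) gchoose n\<bar> \<le> 1"
proof (induction n)
  case (Suc n)
  have eq: "(1/2 :: real) gchoose Suc n = (1/2 gchoose n) * ((1/2 - n) / Suc n)"
  proof -
    have "real (Suc n) * (1/2 gchoose Suc n) = (1/2 - real n) * (1/2 gchoose n)"
      by (simp only: gbinomial_absorb_comp gbinomial_absorption)
    then show ?thesis by (simp add: eq_divide_eq mult.commute del: of_nat_Suc)
  qed
  have "\<bar>(1/2 - real n) / real (Suc n)\<bar> \<le> 1" by (simp add: abs_divide)
  then show ?case unfolding eq abs_mult using Suc mult_mono[of _ 1 _ "1::real"] by fastforce
qed simp

text \<open>The root is the binomial series for exponent 1/2 at \<open>- b\<close>. Its Cauchy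
  square has, by Vandermonde, the coefficients for exponent 1; the real coefficients make it
  selfadjoint.\<close>

lemma selfadjoint_sqrt_one_minus:
  fixes b :: "'a::cstar_algebra"
  assumes "b\<^sup>\<star> = b" "norm b < 1"
  shows "\<exists>c. c\<^sup>\<star> = c \<and> c * c = 1 - b"
proof -
  define f where "f n = ((1/2 :: real) gchoose n) *\<^sub>R (- b) ^ n" for n
  have sn: "summable (\<lambda>n. norm (f n))"
  proof (rule summable_comparison_test')
    show "summable (\<lambda>n. norm b ^ n)" using assms(2) by (simp add: summable_geometric)
    fix n
    have "norm (f n) \<le> 1 * norm (- b) ^ n"
      unfolding f_def norm_scaleR by (intro mult_mono norm_power_ineq abs_half_gbinomial_le) auto
    then show "norm (norm (f n)) \<le> norm b ^ n" by simp
  qed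
  define c where "c = suminf f"
  have "(\<lambda>k. \<Sum>i\<le>k. f i * f (k - i)) sums (c * c)"
    unfolding c_def by (rule Cauchy_product_sums[OF sn sn])
  moreover have "(\<Sum>i\<le>k. f i * f (k - i)) = ((1 :: real) gchoose k) *\<^sub>R (- b) ^ k" for k
  proof -
    have "(\<Sum>i\<le>k. f i * f (k - i)) =
        (\<Sum>i\<le>k. ((1/2 gchoose i) * (1/2 gchoose (k - i)) :: real) *\<^sub>R (- b) ^ k)"
    proof (rule sum.cong)
      fix i assume "i \<in> {..k}"
      then have "(- b) ^ k = (- b) ^ i * (- b) ^ (k - i)" by (simp flip: power_add)
      then show "f i * f (k - i) = ((1/2 gchoose i) * (1/2 gchoose (k - i)) :: real) *\<^sub>R (- b) ^ k"
        by (simp only: f_def mult_scaleR_left mult_scaleR_right scaleR_scaleR mult.commute)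
    qed simp
    then show ?thesis
      using gbinomial_Vandermonde[of "1/2 :: real" "1/2" k]
      by (simp add: atMost_atLeast0 flip: scaleR_sum_left)
  qed
  moreover have "(\<lambda>k. ((1 :: real) gchoose k) *\<^sub>R (- b) ^ k) sums (1 - b)"
  proof -
    \<comment> \<open>For exponent 1 the series stops after the linear term, leaving
      \<open>1 - b\<close>.\<close>
    have "(1 :: real) gchoose k = 0" if "k \<notin> {..1}" for k
      using that binomial_gbinomial[of 1 k, where ?'a = real] by (simp add: binomial_eq_0)
    then have "(\<lambda>k. ((1 :: real) gchoose k) *\<^sub>R (- b) ^ k) sums (\<Sum>k\<le>1. ((1 :: real) gchoose k) *\<^sub>R (- b) ^ k)"
      by (intro sums_finite) auto
    then show ?thesis by simp
  qed
  ultimately have "c * c = 1 - b" by (simp add: sums_unique2)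
  moreover have "c\<^sup>\<star> = c"
  proof -
    have "(\<lambda>n. (f n)\<^sup>\<star>) sums c\<^sup>\<star>"
      unfolding c_def
      by (rule bounded_linear.sums[OF bounded_linear_star summable_sums[OF summable_norm_cancel[OF sn]]])
    moreover have "(f n)\<^sup>\<star> = f n" for n
      by (simp add: f_def star_scaleR star_power star_minus assms(1))
    ultimately show ?thesis unfolding c_def by (simp add: sums_unique)
  qed
  ultimately show ?thesis by blast
qed

section \<open>Operators, adjoints and contractivity of representations\<close>

lemma bop_apply_linear_simps [simp]:
  "T \<bullet>\<^sub>v (x + y) = T \<bullet>\<^sub>v x + T \<bullet>\<^sub>v y" "T \<bullet>\<^sub>v (x - y) = T \<bullet>\<^sub>v x - T \<bullet>\<^sub>v y"
  "T \<bullet>\<^sub>v 0 = 0" "T \<bullet>\<^sub>v sum f A = (\<Sum>i\<in>A. T \<bullet>\<^sub>v f i)"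
  using bounded_linear.linear[OF bounded_linear_bop_apply, of T]
  by (simp_all add: linear_add linear_diff linear_0 linear_sum)

lemma bop_zero_apply: "0 \<bullet>\<^sub>v x = 0"
  using bop_add_apply[of 0 0 x] by simp

lemma bop_diff_apply: "(S - T) \<bullet>\<^sub>v x = S \<bullet>\<^sub>v x - T \<bullet>\<^sub>v x"
  using bop_add_apply[of "S - T" T x] by (simp add: algebra_simps)

lemma bop_sum_apply: "sum f A \<bullet>\<^sub>v x = (\<Sum>i\<in>A. f i \<bullet>\<^sub>v x)"
  by (induction A rule: infinite_finite_induct) (simp_all add: bop_zero_apply bop_add_apply)

lemma inner_bop_star: "inner x (T\<^sup>\<star> \<bullet>\<^sub>v y) = inner (T \<bullet>\<^sub>v x) y" for T :: "'i bop"
  by (simp add: inner_ell2_def cinner_star)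

lemma ell2_apply_star_basis:
  "ell2_apply (T\<^sup>\<star> \<bullet>\<^sub>v ell2_basis j) i = cnj (ell2_apply (T \<bullet>\<^sub>v ell2_basis i) j)" for T :: "'i bop"
  by (metis cinner_basis_left cinner_star cinner_commute)

lemma bop_starI_basis:
  fixes T S :: "'i bop"
  assumes "\<And>i j. cnj (ell2_apply (T \<bullet>\<^sub>v ell2_basis i) j) = ell2_apply (S \<bullet>\<^sub>v ell2_basis j) i"
  shows "T\<^sup>\<star> = S"
proof (rule bop_eqI_basis)
  fix j
  have "ell2_apply (T\<^sup>\<star> \<bullet>\<^sub>v ell2_basis j) i = ell2_apply (S \<bullet>\<^sub>v ell2_basis j) i" for i
    by (simp add: ell2_apply_star_basis assms)
  then show "T\<^sup>\<star> \<bullet>\<^sub>v ell2_basis j = S \<bullet>\<^sub>v ell2_basis j"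
    by (intro iffD1[OF ell2_apply_inject] ext)
qed

lemma unital_star_homD:
  assumes "unital_star_hom \<pi>"
  shows "\<pi> (x + y) = \<pi> x + \<pi> y" "\<pi> (c *\<^sub>C x) = c *\<^sub>C \<pi> x" "\<pi> (x * y) = \<pi> x * \<pi> y"
    "\<pi> (x\<^sup>\<star>) = (\<pi> x)\<^sup>\<star>" "\<pi> 1 = 1" "\<pi> (x - y) = \<pi> x - \<pi> y" "\<pi> 0 = 0"
proof -
  show h: "\<pi> (x + y) = \<pi> x + \<pi> y" "\<pi> (c *\<^sub>C x) = c *\<^sub>C \<pi> x" "\<pi> (x * y) = \<pi> x * \<pi> y"
    "\<pi> (x\<^sup>\<star>) = (\<pi> x)\<^sup>\<star>" "\<pi> 1 = 1" for x y c
    using assms by (auto simp: unital_star_hom_def clinear_def)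
  show "\<pi> (x - y) = \<pi> x - \<pi> y" for x y using h(1)[of "x - y" y] by (simp add: algebra_simps)
  from this[of 0 0] show "\<pi> 0 = 0" by simp
qed

lemma unital_star_hom_compose:
  "unital_star_hom \<pi> \<Longrightarrow> unital_star_hom \<sigma> \<Longrightarrow> unital_star_hom (\<lambda>x. \<sigma> (\<pi> x))"
  by (simp add: unital_star_hom_def clinear_def)

text \<open>If \<open>norm a < 1\<close>, then \<open>1 - a\<^sup>\<star> * a\<close> is the square
  of a selfadjoint \<open>c\<close>. Applying \<open>\<pi>\<close> shows that
  \<open>1 - (\<pi> a)\<^sup>\<star> * \<pi> a\<close> is positive, so \<open>\<pi> a\<close> is a
  contraction; rescaling gives the general bound.\<close>

lemma unital_star_hom_norm_le:
  fixes \<pi> :: "'a::cstar_algebra \<Rightarrow> 'i bop"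
  assumes \<pi>: "unital_star_hom \<pi>"
  shows "norm (\<pi> x) \<le> norm x"
proof -
  have le1: "norm (\<pi> a) \<le> 1" if "norm a < 1" for a
  proof -
    have "norm (a\<^sup>\<star> * a) < 1" using that by (simp add: cstar_identity power_less_one_iff abs_square_less_1)
    then obtain c where c: "c\<^sup>\<star> = c" "c * c = 1 - a\<^sup>\<star> * a"
      using selfadjoint_sqrt_one_minus[of "a\<^sup>\<star> * a"] by (auto simp: star_mult)
    have pc: "(\<pi> c)\<^sup>\<star> * \<pi> c = 1 - (\<pi> a)\<^sup>\<star> * \<pi> a"
      using c by (metis unital_star_homD(3-6)[OF \<pi>])
    have "norm (\<pi> a \<bullet>\<^sub>v h) \<le> 1 * norm h" for h
    proof -
      have "(norm h)\<^sup>2 - (norm (\<pi> a \<bullet>\<^sub>v h))\<^sup>2 = inner h ((1 - (\<pi> a)\<^sup>\<star> * \<pi> a) \<bullet>\<^sub>v h)"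
        by (simp add: power2_norm_eq_inner bop_diff_apply bop_one_apply bop_times_apply inner_bop_star
            inner_diff_right)
      also have "\<dots> = (norm (\<pi> c \<bullet>\<^sub>v h))\<^sup>2"
        by (simp add: power2_norm_eq_inner bop_times_apply inner_bop_star flip: pc)
      finally have "(norm (\<pi> a \<bullet>\<^sub>v h))\<^sup>2 \<le> (norm h)\<^sup>2" by (smt (verit) zero_le_power2)
      then show ?thesis by (simp add: power2_le_iff_abs_le)
    qed
    then show ?thesis by (intro norm_bop_bound) auto
  qed
  show ?thesis
  proof (rule field_le_epsilon)
    fix e :: real assume "e > 0"
    \<comment> \<open>The margin \<open>e\<close> gives the strict inequality required by
      \<open>le1\<close> and keeps \<open>r\<close> positive even for \<open>x = 0\<close>.\<close>
    define r where "r = norm x + e"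
    have r: "r > 0" "norm x < r" using \<open>e > 0\<close> by (auto simp: r_def add_nonneg_pos)
    have "norm (\<pi> (complex_of_real (1 / r) *\<^sub>C x)) \<le> 1"
      by (rule le1) (use r in \<open>simp add: norm_divide divide_simps\<close>)
    then have "norm (\<pi> x) \<le> r"
      using r by (simp add: unital_star_homD(2)[OF \<pi>] norm_divide divide_simps split: if_splits)
    then show "norm (\<pi> x) \<le> norm x + e" by (simp add: r_def)
  qed
qed

section \<open>Tensor products of operators as representations\<close>

lemma ell2_tensor_add_left: "(x + y) \<otimes>\<^sub>h z = x \<otimes>\<^sub>h z + y \<otimes>\<^sub>h z"
  and ell2_tensor_add_right: "z \<otimes>\<^sub>h (x + y) = z \<otimes>\<^sub>h x + z \<otimes>\<^sub>h y"
  and ell2_tensor_scaleC_left: "(c *\<^sub>C x) \<otimes>\<^sub>h z = c *\<^sub>C (x \<otimes>\<^sub>h z)"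
  and ell2_tensor_scaleC_right: "z \<otimes>\<^sub>h (c *\<^sub>C x) = c *\<^sub>C (z \<otimes>\<^sub>h x)"
  and ell2_tensor_zero_left: "0 \<otimes>\<^sub>h z = 0"
  by (rule iffD1[OF ell2_apply_inject], simp add: fun_eq_iff ell2_tensor.rep_eq plus_ell2.rep_eq
      scaleC_ell2.rep_eq zero_ell2.rep_eq algebra_simps)+

text \<open>The tensor is supported on the single slice with first index \<open>i\<close>, where it
  copies \<open>x\<close>. Tensoring with the vacuum is thus isometric.\<close>

lemma norm_ell2_basis_tensor: "norm (ell2_basis i \<otimes>\<^sub>h x) = norm x"
proof -
  have "(norm (ell2_basis i \<otimes>\<^sub>h x))\<^sup>2 =
      (\<Sum>\<^sub>\<infinity>p\<in>Pair i ` UNIV. (cmod (ell2_apply (ell2_basis i \<otimes>\<^sub>h x) p))\<^sup>2)"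
    unfolding norm_ell2_square
    by (rule infsum_cong_neutral) (auto simp: ell2_tensor.rep_eq ell2_basis.rep_eq)
  also have "\<dots> = (norm x)\<^sup>2"
    unfolding norm_ell2_square
    by (subst infsum_reindex) (auto simp: inj_on_def o_def ell2_tensor.rep_eq ell2_basis.rep_eq)
  finally show ?thesis by (simp add: power2_eq_iff_nonneg)
qed

lemma op_tensor_mult: "op_tensor S T * op_tensor S' T' = op_tensor (S * S') (T * T')"
  by (rule bop_eqI_tensor) (simp add: bop_times_apply op_tensor_apply)

lemma op_tensor_one: "op_tensor 1 1 = 1"
  by (rule bop_eqI_tensor) (simp add: op_tensor_apply bop_one_apply)

lemma op_tensor_star: "(op_tensor S T)\<^sup>\<star> = op_tensor (S\<^sup>\<star>) (T\<^sup>\<star>)" for S :: "'i bop" and T :: "'j bop"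
proof (rule bop_starI_basis)
  fix p q :: "'i \<times> 'j"
  show "cnj (ell2_apply (op_tensor S T \<bullet>\<^sub>v ell2_basis p) q) =
      ell2_apply (op_tensor (S\<^sup>\<star>) (T\<^sup>\<star>) \<bullet>\<^sub>v ell2_basis q) p"
    by (cases p; cases q) (simp add: ell2_basis_pair op_tensor_apply ell2_tensor.rep_eq ell2_apply_star_basis)
qed

lemma unital_star_hom_op_tensor_left: "unital_star_hom (\<lambda>S :: 'i bop. op_tensor S (1 :: 'j bop))"
  and unital_star_hom_op_tensor_right: "unital_star_hom (\<lambda>T :: 'j bop. op_tensor (1 :: 'i bop) T)"
  unfolding unital_star_hom_def clinear_def
  by (auto simp: op_tensor_mult op_tensor_one op_tensor_star op_tensor_apply bop_add_apply bop_scaleC_apply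
      ell2_tensor_add_left ell2_tensor_add_right ell2_tensor_scaleC_left ell2_tensor_scaleC_right
      intro!: bop_eqI_tensor)

section \<open>Transport of operators along bijections of index sets\<close>

text \<open>For injective \<open>g\<close> this is the isometry with \<open>ell2_basis i \<mapsto> ell2_basis (g i)\<close>.\<close>

definition ell2_push :: "('i \<Rightarrow> 'j) \<Rightarrow> 'i ell2 \<Rightarrow> 'j ell2" where
  "ell2_push g x = Abs_ell2 (\<lambda>j. if j \<in> range g then ell2_apply x (inv g j) else 0)"

lemma
  assumes g: "inj g"
  shows ell2_push_apply: "ell2_apply (ell2_push g x) j = (if j \<in> range g then ell2_apply x (inv g j) else 0)"
    and norm_ell2_push: "norm (ell2_push g x) = norm x"
proof -
  define f where "f j = (if j \<in> range g then ell2_apply x (inv g j) else 0)" for j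
  have "(\<lambda>i. (cmod (ell2_apply x i))\<^sup>2) = (\<lambda>j. (cmod (f j))\<^sup>2) \<circ> g"
    using g by (auto simp: f_def fun_eq_iff)
  then have "(\<lambda>j. (cmod (f j))\<^sup>2) summable_on range g"
    and eq: "(norm x)\<^sup>2 = (\<Sum>\<^sub>\<infinity>j\<in>range g. (cmod (f j))\<^sup>2)"
    using ell2_apply[of x] by (simp_all add: norm_ell2_square summable_on_reindex[OF g] infsum_reindex[OF g])
  then have "(\<lambda>j. (cmod (f j))\<^sup>2) summable_on UNIV"
    by (subst summable_on_cong_neutral[where T = "range g"]) (auto simp: f_def)
  then have f: "ell2_apply (ell2_push g x) = f"
    unfolding ell2_push_def f_def[abs_def] by (simp add: Abs_ell2_inverse)
  then show "ell2_apply (ell2_push g x) j = (if j \<in> range g then ell2_apply x (inv g j) else 0)"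
    by (simp add: f_def)
  have "(norm (ell2_push g x))\<^sup>2 = (\<Sum>\<^sub>\<infinity>j\<in>range g. (cmod (f j))\<^sup>2)"
    unfolding norm_ell2_square f by (rule infsum_cong_neutral) (auto simp: f_def)
  then show "norm (ell2_push g x) = norm x" by (simp add: power2_eq_iff_nonneg flip: eq)
qed

lemma ell2_push_add: "inj g \<Longrightarrow> ell2_push g (x + y) = ell2_push g x + ell2_push g y"
  and ell2_push_scaleC: "inj g \<Longrightarrow> ell2_push g (c *\<^sub>C x) = c *\<^sub>C ell2_push g x"
  by (rule iffD1[OF ell2_apply_inject],
      simp add: fun_eq_iff ell2_push_apply plus_ell2.rep_eq scaleC_ell2.rep_eq)+

lemma ell2_push_basis: "inj g \<Longrightarrow> ell2_push g (ell2_basis i) = ell2_basis (g i)"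
  by (rule iffD1[OF ell2_apply_inject]) (auto simp: fun_eq_iff ell2_push_apply ell2_basis.rep_eq inj_eq)

lemma ell2_push_inv: "bij e \<Longrightarrow> ell2_push (inv e) (ell2_push e x) = x"
  "bij e \<Longrightarrow> ell2_push e (ell2_push (inv e) y) = y"
  by (rule iffD1[OF ell2_apply_inject],
      simp add: fun_eq_iff ell2_push_apply bij_is_inj bij_is_surj bij_imp_bij_inv inv_inv_eq surj_f_inv_f)+

text \<open>Conjugation by the unitary that a bijection \<open>e\<close> induces. It carries
  representations on product index sets back to a prescribed Hilbert space.\<close>

definition bop_reindex :: "('i \<Rightarrow> 'j) \<Rightarrow> 'i bop \<Rightarrow> 'j bop" where
  "bop_reindex e T = (SOME W. \<forall>y. W \<bullet>\<^sub>v y = ell2_push e (T \<bullet>\<^sub>v ell2_push (inv e) y))"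

lemma bop_reindex_apply:
  assumes "bij e"
  shows "bop_reindex e T \<bullet>\<^sub>v y = ell2_push e (T \<bullet>\<^sub>v ell2_push (inv e) y)"
proof -
  have i: "inj e" "inj (inv e)" using assms by (simp_all add: bij_is_inj bij_imp_bij_inv)
  have "\<exists>W. \<forall>y. W \<bullet>\<^sub>v y = ell2_push e (T \<bullet>\<^sub>v ell2_push (inv e) y)"
  proof (rule bop_exI)
    show "norm (ell2_push e (T \<bullet>\<^sub>v ell2_push (inv e) x)) \<le> norm T * norm x" for x
      using norm_bop_apply_le[of T "ell2_push (inv e) x"] by (simp add: norm_ell2_push i)
  qed (simp_all add: ell2_push_add ell2_push_scaleC i)
  then show ?thesis unfolding bop_reindex_def by (rule someI2_ex) blast
qed

lemma norm_bop_reindex: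
  assumes "bij e"
  shows "norm (bop_reindex e T) = norm T"
proof (rule antisym)
  have i: "inj e" "inj (inv e)" using assms by (simp_all add: bij_is_inj bij_imp_bij_inv)
  have "norm (bop_reindex e T \<bullet>\<^sub>v x) \<le> norm T * norm x" for x
    using norm_bop_apply_le[of T "ell2_push (inv e) x"] by (simp add: bop_reindex_apply assms norm_ell2_push i)
  then show "norm (bop_reindex e T) \<le> norm T" by (intro norm_bop_bound) auto
  have "norm (T \<bullet>\<^sub>v x) \<le> norm (bop_reindex e T) * norm x" for x
    using norm_bop_apply_le[of "bop_reindex e T" "ell2_push e x"]
    by (simp add: bop_reindex_apply assms norm_ell2_push i ell2_push_inv)
  then show "norm T \<le> norm (bop_reindex e T)" by (intro norm_bop_bound) auto
qed

lemma unital_star_hom_bop_reindex: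
  fixes e :: "'i \<Rightarrow> 'j"
  assumes e: "bij e"
  shows "unital_star_hom (bop_reindex e)"
proof -
  have i: "inj e" "inj (inv e)" using e by (simp_all add: bij_is_inj bij_imp_bij_inv)
  have "(bop_reindex e T)\<^sup>\<star> = bop_reindex e (T\<^sup>\<star>)" for T
  proof (rule bop_starI_basis)
    fix j k
    show "cnj (ell2_apply (bop_reindex e T \<bullet>\<^sub>v ell2_basis j) k) =
        ell2_apply (bop_reindex e (T\<^sup>\<star>) \<bullet>\<^sub>v ell2_basis k) j"
      using bij_is_surj[OF e]
      by (simp add: bop_reindex_apply[OF e] ell2_push_basis i ell2_push_apply ell2_apply_star_basis)
  qed
  then show ?thesis
    unfolding unital_star_hom_def clinear_def
    by (auto intro!: bop_eqI simp: bop_reindex_apply[OF e] bop_add_apply bop_scaleC_apply bop_times_apply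
        bop_one_apply ell2_push_add ell2_push_scaleC ell2_push_inv[OF e] i)
qed

section \<open>A representation with a vacuum vector\<close>

lemma cuntz_isometriesI:
  fixes S :: "nat \<Rightarrow> 'a::cstar_algebra"
  assumes S: "\<And>i j. (S i)\<^sup>\<star> * S j = (if i = j then 1 else 0)"
  shows "cuntz_isometries S"
  unfolding cuntz_isometries_def
proof (intro conjI allI)
  fix k
  define p where "p = (\<Sum>i<k. S i * (S i)\<^sup>\<star>)"
  have "(S i * (S i)\<^sup>\<star>) * (S j * (S j)\<^sup>\<star>) = (if i = j then S i * (S i)\<^sup>\<star> else 0)" for i j
  proof -
    have "(S i * (S i)\<^sup>\<star>) * (S j * (S j)\<^sup>\<star>) = S i * ((S i)\<^sup>\<star> * S j) * (S j)\<^sup>\<star>" by (simp add: mult.assoc)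
    then show ?thesis by (simp add: S)
  qed
  then have "p * p = p" by (simp add: p_def sum_product)
  moreover have "p\<^sup>\<star> = p" by (simp add: p_def star_sum star_mult)
  \<comment> \<open>Orthogonal ranges make \<open>p\<close> a projection, so \<open>1 - p\<close> is
    its own square root and witnesses the order relation.\<close>
  ultimately have "1 - p = (1 - p)\<^sup>\<star> * (1 - p)" by (simp add: star_diff algebra_simps)
  then show "(\<Sum>i<k. S i * (S i)\<^sup>\<star>) \<le>\<^sub>* 1" unfolding cstar_le_def p_def by blast
qed (simp add: S)

text \<open>For \<open>y = T j h\<close> the order relation gives a Bessel inequality for the
  vectors \<open>(T l)\<^sup>\<star> y\<close>. The term \<open>l = j\<close> already exhausts the
  norm of \<open>y\<close>, so the term \<open>l = i\<close> must vanish.\<close>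

lemma cuntz_isometries_hom_orthogonal:
  fixes S :: "nat \<Rightarrow> 'a::cstar_algebra" and \<pi> :: "'a \<Rightarrow> 'i bop"
  assumes S: "cuntz_isometries S" and \<pi>: "unital_star_hom \<pi>"
  shows "(\<pi> (S i))\<^sup>\<star> * \<pi> (S j) = (if i = j then 1 else 0)"
proof -
  note hom = unital_star_homD[OF \<pi>]
  define T where "T i = \<pi> (S i)" for i
  have iso: "(T i)\<^sup>\<star> * T i = 1" for i
    using S by (simp add: T_def cuntz_isometries_def flip: hom)
  have "(T i)\<^sup>\<star> * T j = 0" if "i \<noteq> j"
  proof (rule bop_eqI)
    fix h
    \<comment> \<open>Just large enough for both \<open>i\<close> and \<open>j\<close> to occur in
      the sum.\<close>
    define k where "k = Suc (max i j)"
    obtain c where c: "1 - (\<Sum>l<k. S l * (S l)\<^sup>\<star>) = c\<^sup>\<star> * c"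
      using S by (auto simp: cuntz_isometries_def cstar_le_def)
    have ps: "\<pi> (sum f A) = (\<Sum>l\<in>A. \<pi> (f l))" for f and A :: "nat set"
      by (induction A rule: infinite_finite_induct) (simp_all add: hom)
    have pc: "1 - (\<Sum>l<k. T l * (T l)\<^sup>\<star>) = (\<pi> c)\<^sup>\<star> * \<pi> c"
      using arg_cong[OF c, of \<pi>] by (simp add: hom ps T_def)
    let ?y = "T j \<bullet>\<^sub>v h"
    have "0 \<le> inner ?y (((\<pi> c)\<^sup>\<star> * \<pi> c) \<bullet>\<^sub>v ?y)" by (simp add: bop_times_apply inner_bop_star)
    also have "\<dots> = inner ?y ?y - (\<Sum>l<k. (norm ((T l)\<^sup>\<star> \<bullet>\<^sub>v ?y))\<^sup>2)"
      unfolding pc[symmetric]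
      by (simp add: bop_diff_apply bop_one_apply bop_sum_apply bop_times_apply inner_diff_right
          inner_sum_right power2_norm_eq_inner inner_bop_star)
        (simp add: inner_bop_star inner_commute flip: star_star)
    finally have "(\<Sum>l<k. (norm ((T l)\<^sup>\<star> \<bullet>\<^sub>v ?y))\<^sup>2) \<le> inner ?y ?y" by simp
    moreover have "(\<Sum>l\<in>{i, j}. (norm ((T l)\<^sup>\<star> \<bullet>\<^sub>v ?y))\<^sup>2) \<le> (\<Sum>l<k. (norm ((T l)\<^sup>\<star> \<bullet>\<^sub>v ?y))\<^sup>2)"
      by (rule sum_mono2) (auto simp: k_def)
    moreover have Tj: "(T j)\<^sup>\<star> \<bullet>\<^sub>v ?y = h" by (simp add: iso bop_one_apply flip: bop_times_apply)
    moreover have "inner ?y ?y = (norm h)\<^sup>2"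
      using inner_bop_star[of h "T j" ?y] by (simp add: Tj power2_norm_eq_inner)
    moreover have "(\<Sum>l\<in>{i, j}. (norm ((T l)\<^sup>\<star> \<bullet>\<^sub>v ?y))\<^sup>2) = (norm ((T i)\<^sup>\<star> \<bullet>\<^sub>v ?y))\<^sup>2 + (norm h)\<^sup>2"
      using that Tj by simp
    ultimately have "(norm ((T i)\<^sup>\<star> \<bullet>\<^sub>v ?y))\<^sup>2 \<le> 0" by linarith
    then show "((T i)\<^sup>\<star> * T j) \<bullet>\<^sub>v h = 0 \<bullet>\<^sub>v h" by (simp add: bop_times_apply bop_zero_apply)
  qed
  then show ?thesis using iso by (simp add: T_def)
qed

text \<open>The isometries permute basis vectors into disjoint blocks given by
  \<open>prod_encode\<close>. The successor in \<open>g\<close> leaves index 0 outside every block,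
  which makes \<open>ell2_basis 0\<close> the vacuum.\<close>

lemma cuntz_isometries_with_vacuum:
  "\<exists>T :: nat \<Rightarrow> nat bop. cuntz_isometries T \<and> (\<forall>i. (T i)\<^sup>\<star> \<bullet>\<^sub>v ell2_basis 0 = 0)"
proof -
  define g where "g i n = Suc (prod_encode (i, n))" for i n
  have g: "inj (g i)" for i by (auto simp: g_def inj_def)
  have "\<exists>T. \<forall>x. T \<bullet>\<^sub>v x = ell2_push (g i) x" for i
    by (rule bop_exI[where K = 1]) (simp_all add: g ell2_push_add ell2_push_scaleC norm_ell2_push)
  then obtain T where T: "\<And>i x. T i \<bullet>\<^sub>v x = ell2_push (g i) x" by metis
  have star: "ell2_apply ((T i)\<^sup>\<star> \<bullet>\<^sub>v y) n = ell2_apply y (g i n)" for i n y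
    by (metis cinner_basis_left cinner_star T ell2_push_basis[OF g])
  have "(T i)\<^sup>\<star> * T j = (if i = j then 1 else 0)" for i j
  proof (rule bop_eqI_basis)
    fix n
    show "((T i)\<^sup>\<star> * T j) \<bullet>\<^sub>v ell2_basis n = (if i = j then 1 else 0) \<bullet>\<^sub>v ell2_basis n"
      by (rule iffD1[OF ell2_apply_inject])
        (auto simp: fun_eq_iff bop_times_apply star T ell2_push_basis[OF g] bop_one_apply bop_zero_apply
          ell2_basis.rep_eq zero_ell2.rep_eq g_def)
  qed
  then have "cuntz_isometries T" by (rule cuntz_isometriesI)
  moreover have "(T i)\<^sup>\<star> \<bullet>\<^sub>v ell2_basis 0 = 0" for i
    by (rule iffD1[OF ell2_apply_inject]) (simp add: fun_eq_iff star ell2_basis.rep_eq zero_ell2.rep_eq g_def)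
  ultimately show ?thesis by blast
qed

text \<open>Cardinal arithmetic of infinite sets; the bijections serve as arguments of
  \<open>bop_reindex\<close>.\<close>

lemma infinite_UNIV_self_product:
  assumes "infinite (UNIV :: 'i set)"
  shows "\<exists>e :: 'i \<times> 'i \<Rightarrow> 'i. bij e" "\<exists>e :: nat \<times> 'i \<Rightarrow> 'i. bij e"
proof -
  show "\<exists>e :: 'i \<times> 'i \<Rightarrow> 'i. bij e"
    using card_of_Times_same_infinite[OF assms] by (simp flip: card_of_ordIso)
  have "\<exists>e. bij_betw e ((UNIV :: nat set) \<times> (UNIV :: 'i set)) (UNIV :: 'i set)"
    unfolding card_of_ordIso
    by (rule card_of_Times_infinite[THEN conjunct2])
      (use assms infinite_iff_card_of_nat[of "UNIV :: 'i set"] in auto)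
  then show "\<exists>e :: nat \<times> 'i \<Rightarrow> 'i. bij e" by simp
qed

text \<open>Universality provides operators on the sequence space over \<open>nat\<close> only.
  Tensoring with the identity and reindexing moves them to \<open>'i\<close>, where the image of the
  basis vector at \<open>(0, j)\<close> is a vacuum.\<close>

lemma vacuum_representation:
  fixes S :: "nat \<Rightarrow> 'o::cstar_algebra"
  assumes S: "is_cuntz_infinity S" and inf: "infinite (UNIV :: 'i set)"
  shows "\<exists>(\<phi> :: 'o \<Rightarrow> 'i bop) k. unital_star_hom \<phi> \<and> (\<forall>i. (\<phi> (S i))\<^sup>\<star> \<bullet>\<^sub>v ell2_basis k = 0)"
proof -
  obtain T :: "nat \<Rightarrow> nat bop" where T: "cuntz_isometries T" "\<And>i. (T i)\<^sup>\<star> \<bullet>\<^sub>v ell2_basis 0 = 0"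
    using cuntz_isometries_with_vacuum by blast
  obtain \<pi> :: "'o \<Rightarrow> nat bop" where \<pi>: "unital_star_hom \<pi>" "\<And>i. \<pi> (S i) = T i"
    using S T(1) unfolding is_cuntz_infinity_def by blast
  obtain e :: "nat \<times> 'i \<Rightarrow> 'i" where e: "bij e" using infinite_UNIV_self_product[OF inf] by blast
  define \<phi> where "\<phi> x = bop_reindex e (op_tensor (\<pi> x) 1)" for x
  have hom: "unital_star_hom \<phi>"
    unfolding \<phi>_def
    by (rule unital_star_hom_compose[OF unital_star_hom_compose[OF \<pi>(1) unital_star_hom_op_tensor_left]
          unital_star_hom_bop_reindex[OF e]])
  have "(\<phi> (S i))\<^sup>\<star> \<bullet>\<^sub>v ell2_basis (e (0, j)) = 0" for i j
  proof -
    have "ell2_push (inv e) (ell2_basis (e (0, j))) = ell2_basis 0 \<otimes>\<^sub>h ell2_basis j"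
      using e by (simp add: ell2_push_basis bij_is_inj bij_imp_bij_inv ell2_basis_pair)
    moreover have "ell2_push e 0 = 0"
      using ell2_push_add[of e 0 0] e by (simp add: bij_is_inj)
    ultimately show ?thesis
      by (simp add: \<phi>_def bop_reindex_apply[OF e] op_tensor_star op_tensor_apply T ell2_tensor_zero_left \<pi>(2)
          flip: unital_star_homD(4)[OF unital_star_hom_bop_reindex[OF e]])
  qed
  then show ?thesis using hom by blast
qed

section \<open>Approximate intertwiners\<close>

lemma orthogonal_isometries_apply:
  fixes V :: "nat \<Rightarrow> 'k bop"
  assumes "\<And>i j. (V i)\<^sup>\<star> * V j = (if i = j then 1 else 0)"
  shows "(V i)\<^sup>\<star> \<bullet>\<^sub>v (V j \<bullet>\<^sub>v x) = (if i = j then x else 0)"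
  using assms[of i j] by (simp add: bop_one_apply bop_zero_apply flip: bop_times_apply)

text \<open>Induction with Pythagoras: \<open>(V N)\<^sup>\<star>\<close> kills \<open>u\<close> and
  all earlier summands, so the new summand is orthogonal to them.\<close>

lemma norm_orthogonal_isometries_sum:
  fixes V :: "nat \<Rightarrow> 'k bop"
  assumes V: "\<And>i j. (V i)\<^sup>\<star> * V j = (if i = j then 1 else 0)"
    and u: "\<And>i. i < N \<Longrightarrow> (V i)\<^sup>\<star> \<bullet>\<^sub>v u = 0"
  shows "(norm (u + (\<Sum>i<N. V i \<bullet>\<^sub>v y i)))\<^sup>2 = (norm u)\<^sup>2 + (\<Sum>i<N. (norm (y i))\<^sup>2)"
  using u
proof (induction N)
  case (Suc N)
  let ?z = "u + (\<Sum>i<N. V i \<bullet>\<^sub>v y i)"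
  have "(V N)\<^sup>\<star> \<bullet>\<^sub>v ?z = 0"
    using Suc.prems by (simp add: orthogonal_isometries_apply[OF V])
  then have "inner (V N \<bullet>\<^sub>v y N) ?z = 0" by (metis inner_bop_star inner_zero_right)
  moreover have "inner (V N \<bullet>\<^sub>v y N) (V N \<bullet>\<^sub>v y N) = (norm (y N))\<^sup>2"
    by (simp add: orthogonal_isometries_apply[OF V] power2_norm_eq_inner flip: inner_bop_star)
  ultimately have "(norm (?z + V N \<bullet>\<^sub>v y N))\<^sup>2 = (norm ?z)\<^sup>2 + (norm (y N))\<^sup>2"
    using norm_add_Pythagorean[of ?z "V N \<bullet>\<^sub>v y N"]
    by (simp only: orthogonal_def inner_commute[of ?z "V N \<bullet>\<^sub>v y N"] power2_norm_eq_inner)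
  then show ?case using Suc by (simp add: add.assoc)
qed simp

text \<open>\<open>T\<close> models the generators in the given representation on H,
  \<open>L\<close> their images under \<open>\<phi> \<otimes> 1\<close> on
  \<open>K \<otimes> H\<close>, and \<open>w\<close> the map
  \<open>h \<mapsto> \<omega> \<otimes> h\<close>.\<close>

locale isometries_with_vacuum =
  fixes T :: "nat \<Rightarrow> 'i bop" and L :: "nat \<Rightarrow> 'k bop" and w :: "'i ell2 \<Rightarrow> 'k ell2"
  assumes T: "\<And>i j. (T i)\<^sup>\<star> * T j = (if i = j then 1 else 0)"
    and L: "\<And>i j. (L i)\<^sup>\<star> * L j = (if i = j then 1 else 0)"
    and w_add: "\<And>x y. w (x + y) = w x + w y"
    and w_scaleC: "\<And>c x. w (c *\<^sub>C x) = c *\<^sub>C w x"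
    and norm_w: "\<And>x. norm (w x) = norm x"
    and vacuum: "\<And>i x. (L i)\<^sup>\<star> \<bullet>\<^sub>v w x = 0"
begin

lemma w_scaleR: "w (r *\<^sub>R x) = r *\<^sub>R w x"
  by (simp add: scaleR_scaleC w_scaleC)

lemma w_diff: "w (x - y) = w x - w y"
  using w_add[of "x - y" y] by (simp add: algebra_simps)

definition range_proj :: "nat \<Rightarrow> 'i ell2 \<Rightarrow> 'i ell2" where
  "range_proj N h = (\<Sum>i<N. T i \<bullet>\<^sub>v ((T i)\<^sup>\<star> \<bullet>\<^sub>v h))"

text \<open>
  With \<open>P\<close> the projection onto the sum of the ranges of \<open>T\<^sub>i\<close>, \<open>i < N\<close>, the \<open>m\<close>-th map is the sum, over
  words \<open>v\<close> of length \<open>l < m\<close> in the letters below \<open>N\<close>, of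
  \<open>L\<^sub>v w ((sqrt (m - l) (1 - P) + P) T\<^sub>v\<^sup>\<star> h)\<close>. These weights make it \<open>sqrt m\<close> times an isometry.
\<close>

primrec word_sum :: "nat \<Rightarrow> nat \<Rightarrow> 'i ell2 \<Rightarrow> 'k ell2" where
  "word_sum N 0 = (\<lambda>h. 0)"
| "word_sum N (Suc m) = (\<lambda>h. w (sqrt (Suc m) *\<^sub>R (h - range_proj N h) + range_proj N h) +
    (\<Sum>i<N. L i \<bullet>\<^sub>v word_sum N m ((T i)\<^sup>\<star> \<bullet>\<^sub>v h)))"

lemma range_proj_add: "range_proj N (x + y) = range_proj N x + range_proj N y"
  by (simp add: range_proj_def sum.distrib)

lemma word_sum_add: "word_sum N m (x + y) = word_sum N m x + word_sum N m y"
  by (induction m arbitrary: x y)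
    (simp_all add: range_proj_add sum.distrib w_add w_scaleR w_diff algebra_simps)

lemma word_sum_diff: "word_sum N m (x - y) = word_sum N m x - word_sum N m y"
  using word_sum_add[of N m "x - y" y] by (simp add: algebra_simps)

lemma star_T_range_proj: "i < N \<Longrightarrow> (T i)\<^sup>\<star> \<bullet>\<^sub>v (h - range_proj N h) = 0"
  by (simp add: range_proj_def orthogonal_isometries_apply[OF T])

lemma norm_range_proj_split:
  "(norm (a *\<^sub>R (h - range_proj N h) + range_proj N h))\<^sup>2 =
    a\<^sup>2 * (norm (h - range_proj N h))\<^sup>2 + (\<Sum>i<N. (norm ((T i)\<^sup>\<star> \<bullet>\<^sub>v h))\<^sup>2)"
proof -
  have "(norm (a *\<^sub>R (h - range_proj N h) + (\<Sum>i<N. T i \<bullet>\<^sub>v ((T i)\<^sup>\<star> \<bullet>\<^sub>v h))))\<^sup>2 =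
      (norm (a *\<^sub>R (h - range_proj N h)))\<^sup>2 + (\<Sum>i<N. (norm ((T i)\<^sup>\<star> \<bullet>\<^sub>v h))\<^sup>2)"
  proof (rule norm_orthogonal_isometries_sum[OF T])
    fix i assume "i < N"
    then show "(T i)\<^sup>\<star> \<bullet>\<^sub>v (a *\<^sub>R (h - range_proj N h)) = 0"
      by (simp only: scaleR_scaleC bop_apply_scaleC star_T_range_proj scaleC_zero_right)
  qed
  then show ?thesis by (simp add: power_mult_distrib flip: range_proj_def)
qed

lemma norm_square_split:
  "(norm h)\<^sup>2 = (norm (h - range_proj N h))\<^sup>2 + (\<Sum>i<N. (norm ((T i)\<^sup>\<star> \<bullet>\<^sub>v h))\<^sup>2)"
  using norm_range_proj_split[of 1 h N] by simp

text \<open>With P the range projection, the empty word contributes \<open>(m + 1) \<parallel>(1 -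
  P) h\<parallel>\<^sup>2 + \<parallel>P h\<parallel>\<^sup>2\<close> and the longer words
  contribute \<open>m \<parallel>P h\<parallel>\<^sup>2\<close> by induction. The total is
  \<open>(m + 1) \<parallel>h\<parallel>\<^sup>2\<close>.\<close>

lemma norm_word_sum_square: "(norm (word_sum N m h))\<^sup>2 = m * (norm h)\<^sup>2"
proof (induction m arbitrary: h)
  case (Suc m)
  have "(norm (word_sum N (Suc m) h))\<^sup>2 =
      (norm (sqrt (Suc m) *\<^sub>R (h - range_proj N h) + range_proj N h))\<^sup>2 +
      (\<Sum>i<N. m * (norm ((T i)\<^sup>\<star> \<bullet>\<^sub>v h))\<^sup>2)"
    unfolding word_sum.simps
    by (subst norm_orthogonal_isometries_sum[OF L vacuum]) (simp only: norm_w Suc)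
  then show ?case
    unfolding norm_range_proj_split using norm_square_split[of h N]
    by (simp add: algebra_simps flip: sum_distrib_left)
qed simp

lemma norm_word_sum: "norm (word_sum N m h) = sqrt m * norm h"
  by (rule power2_eq_imp_eq) (simp_all add: norm_word_sum_square power_mult_distrib)

text \<open>In the difference the unweighted range part of the head cancels, and the weights of the
  remainder differ by at most 1. Pythagoras and induction on the tails give a bound independent of
  \<open>m\<close>, while the maps themselves grow like \<open>sqrt m\<close>.\<close>

lemma norm_word_sum_Suc_diff: "norm (word_sum N (Suc m) h - word_sum N m h) \<le> norm h"
proof (rule power2_le_imp_le)
  show "(norm (word_sum N (Suc m) h - word_sum N m h))\<^sup>2 \<le> (norm h)\<^sup>2"
  proof (induction m arbitrary: h)
    case 0
    show ?case using norm_word_sum_square[of N 1 h] by simp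
  next
    case (Suc m)
    let ?d = "sqrt (Suc (Suc m)) - sqrt (Suc m)"
    have "word_sum N (Suc (Suc m)) h - word_sum N (Suc m) h = w (?d *\<^sub>R (h - range_proj N h)) +
        (\<Sum>i<N. L i \<bullet>\<^sub>v (word_sum N (Suc m) ((T i)\<^sup>\<star> \<bullet>\<^sub>v h) - word_sum N m ((T i)\<^sup>\<star> \<bullet>\<^sub>v h)))"
      unfolding word_sum.simps(2)[of N "Suc m"] word_sum.simps(2)[of N m, THEN fun_cong, of h]
      by (simp del: word_sum.simps add: sum_subtractf w_add w_diff w_scaleR algebra_simps)
    then have "(norm (word_sum N (Suc (Suc m)) h - word_sum N (Suc m) h))\<^sup>2 =
        (norm (w (?d *\<^sub>R (h - range_proj N h))))\<^sup>2 +
        (\<Sum>i<N. (norm (word_sum N (Suc m) ((T i)\<^sup>\<star> \<bullet>\<^sub>v h) - word_sum N m ((T i)\<^sup>\<star> \<bullet>\<^sub>v h)))\<^sup>2)"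
      by (simp only: norm_orthogonal_isometries_sum[OF L vacuum])
    also have "\<dots> \<le> (norm (h - range_proj N h))\<^sup>2 + (\<Sum>i<N. (norm ((T i)\<^sup>\<star> \<bullet>\<^sub>v h))\<^sup>2)"
    proof (intro add_mono sum_mono Suc.IH)
      have "?d \<le> sqrt 1"
        using sqrt_add_le_add_sqrt[of "Suc m" 1] by (simp add: add.commute)
      moreover have "0 \<le> ?d" by simp
      ultimately have "\<bar>?d\<bar> * norm (h - range_proj N h) \<le> 1 * norm (h - range_proj N h)"
        by (intro mult_right_mono) auto
      then show "(norm (w (?d *\<^sub>R (h - range_proj N h))))\<^sup>2 \<le> (norm (h - range_proj N h))\<^sup>2"
        unfolding norm_w norm_scaleR by (intro power_mono) auto
    qed
    finally show ?case by (simp only: flip: norm_square_split)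
  qed
qed simp

text \<open>The adjoint strips the first letter: the vacuum part and the words starting with another
  letter vanish. The only defect is the drop in length by one.\<close>

lemma star_L_word_sum_Suc: "i < N \<Longrightarrow> (L i)\<^sup>\<star> \<bullet>\<^sub>v word_sum N (Suc m) h = word_sum N m ((T i)\<^sup>\<star> \<bullet>\<^sub>v h)"
  by (simp add: vacuum orthogonal_isometries_apply[OF L])

text \<open>The vector \<open>T i h\<close> is fixed by the range projection, so the growing weight
  does not apply to it and the vacuum term has norm \<open>norm h\<close> for every
  \<open>m\<close>.\<close>

lemma word_sum_Suc_T:
  assumes "i < N"
  shows "word_sum N (Suc m) (T i \<bullet>\<^sub>v h) = w (T i \<bullet>\<^sub>v h) + L i \<bullet>\<^sub>v word_sum N m h"
proof -
  have z: "word_sum N m 0 = 0" using word_sum_diff[of N m 0 0] by simp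
  have "range_proj N (T i \<bullet>\<^sub>v h) = T i \<bullet>\<^sub>v h"
    using assms by (simp add: range_proj_def orthogonal_isometries_apply[OF T] if_distrib cong: if_cong)
  then show ?thesis
    using assms by (simp add: orthogonal_isometries_apply[OF T] if_distrib z cong: if_cong)
qed

section \<open>Asymptotic intertwining of operators\<close>

text \<open>
  \<open>word_sum n n / sqrt n\<close> is an isometry; \<open>approx_intertwined X Y\<close> says that asymptotically it
  intertwines \<open>X\<close> and \<open>Y\<close> in norm.
\<close>

definition approx_intertwined :: "'i bop \<Rightarrow> 'k bop \<Rightarrow> bool" where
  "approx_intertwined X Y \<longleftrightarrow> (\<forall>e>0. \<forall>\<^sub>F n in sequentially. \<forall>h.
    norm (Y \<bullet>\<^sub>v word_sum n n h - word_sum n n (X \<bullet>\<^sub>v h)) \<le> e * (sqrt n * norm h))"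

text \<open>An error bounded independently of \<open>n\<close> suffices, because the normalisation
  \<open>sqrt n\<close> diverges. The threshold \<open>N\<close> lets \<open>n\<close> grow until a
  given letter is among those in use.\<close>

lemma approx_intertwinedI:
  assumes "\<And>(n :: nat) h. n > N \<Longrightarrow> norm (Y \<bullet>\<^sub>v word_sum n n h - word_sum n n (X \<bullet>\<^sub>v h)) \<le> C * norm h"
  shows "approx_intertwined X Y"
  unfolding approx_intertwined_def
proof (intro allI impI)
  fix e :: real assume "e > 0"
  have "filterlim (\<lambda>n. sqrt (real n)) at_top sequentially"
    by (rule filterlim_compose[OF sqrt_at_top filterlim_real_sequentially])
  then have "\<forall>\<^sub>F n in sequentially. C / e \<le> sqrt n" by (simp add: filterlim_at_top)
  with eventually_gt_at_top[of N]
  show "\<forall>\<^sub>F n in sequentially. \<forall>h.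
    norm (Y \<bullet>\<^sub>v word_sum n n h - word_sum n n (X \<bullet>\<^sub>v h)) \<le> e * (sqrt n * norm h)"
  proof eventually_elim
    case (elim n)
    then have "C \<le> e * sqrt n" using \<open>e > 0\<close> by (simp add: divide_le_eq mult.commute)
    show ?case
    proof
      fix h :: "'i ell2"
      have "C * norm h \<le> (e * sqrt n) * norm h"
        by (rule mult_right_mono[OF \<open>C \<le> e * sqrt n\<close>]) simp
      then show "norm (Y \<bullet>\<^sub>v word_sum n n h - word_sum n n (X \<bullet>\<^sub>v h)) \<le> e * (sqrt n * norm h)"
        using assms[OF elim(1), of h] by (simp add: mult.assoc)
    qed
  qed
qed

lemma approx_intertwined_T: "approx_intertwined (T i) (L i)"
proof (rule approx_intertwinedI[of i _ _ 2])
  fix n :: nat and h :: "'i ell2" assume n: "i < n"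
  have "norm (T i \<bullet>\<^sub>v h) = norm h"
    using orthogonal_isometries_apply[OF T, of i i h] inner_bop_star[of h "T i" "T i \<bullet>\<^sub>v h"]
    by (simp add: norm_eq_sqrt_inner)
  \<comment> \<open>One increment in length and one vacuum term, each of norm at most
    \<open>norm h\<close>; hence the constant 2.\<close>
  moreover have eq: "L i \<bullet>\<^sub>v word_sum n n h - word_sum n n (T i \<bullet>\<^sub>v h) =
      (word_sum n (Suc n) (T i \<bullet>\<^sub>v h) - word_sum n n (T i \<bullet>\<^sub>v h)) - w (T i \<bullet>\<^sub>v h)"
    by (simp only: word_sum_Suc_T[OF n]) simp
  ultimately show "norm (L i \<bullet>\<^sub>v word_sum n n h - word_sum n n (T i \<bullet>\<^sub>v h)) \<le> 2 * norm h"
    unfolding eq using norm_triangle_ineq4[of "word_sum n (Suc n) (T i \<bullet>\<^sub>v h) - word_sum n n (T i \<bullet>\<^sub>v h)" "w (T i \<bullet>\<^sub>v h)"]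
      norm_word_sum_Suc_diff[of n n "T i \<bullet>\<^sub>v h"] norm_w[of "T i \<bullet>\<^sub>v h"] by linarith
qed

lemma approx_intertwined_star_T: "approx_intertwined ((T i)\<^sup>\<star>) ((L i)\<^sup>\<star>)"
proof (rule approx_intertwinedI[of i _ _ "norm (L i)"])
  fix n :: nat and h :: "'i ell2" assume n: "i < n"
  have "(L i)\<^sup>\<star> \<bullet>\<^sub>v word_sum n n h - word_sum n n ((T i)\<^sup>\<star> \<bullet>\<^sub>v h) =
      (L i)\<^sup>\<star> \<bullet>\<^sub>v (word_sum n n h - word_sum n (Suc n) h)"
    by (simp only: bop_apply_linear_simps star_L_word_sum_Suc[OF n])
  also have "norm \<dots> \<le> norm (L i) * norm (word_sum n n h - word_sum n (Suc n) h)"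
    using norm_bop_apply_le[of "(L i)\<^sup>\<star>"] by (simp only: norm_star)
  also have "\<dots> \<le> norm (L i) * norm h"
    using norm_word_sum_Suc_diff[of n n h] by (intro mult_left_mono) (simp_all only: norm_minus_commute norm_ge_zero)
  finally show "norm ((L i)\<^sup>\<star> \<bullet>\<^sub>v word_sum n n h - word_sum n n ((T i)\<^sup>\<star> \<bullet>\<^sub>v h)) \<le> norm (L i) * norm h" .
qed

text \<open>By induction on the length, \<open>X\<close> passes through the adjoints and the range
  projection while \<open>Y\<close> passes through \<open>L i\<close> and \<open>w\<close>, so the
  error is zero. This covers scalars and the operators \<open>\<rho> y\<close>.\<close>

lemma approx_intertwined_exact:
  assumes "\<And>i. X * T i = T i * X" "\<And>i. X * (T i)\<^sup>\<star> = (T i)\<^sup>\<star> * X" "\<And>i. Y * L i = L i * Y"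
    and "\<And>h. w (X \<bullet>\<^sub>v h) = Y \<bullet>\<^sub>v w h"
  shows "approx_intertwined X Y"
proof -
  have XT: "X \<bullet>\<^sub>v (T i \<bullet>\<^sub>v h) = T i \<bullet>\<^sub>v (X \<bullet>\<^sub>v h)" "(T i)\<^sup>\<star> \<bullet>\<^sub>v (X \<bullet>\<^sub>v h) = X \<bullet>\<^sub>v ((T i)\<^sup>\<star> \<bullet>\<^sub>v h)"
    and YL: "Y \<bullet>\<^sub>v (L i \<bullet>\<^sub>v g) = L i \<bullet>\<^sub>v (Y \<bullet>\<^sub>v g)" for i h g
    using assms(1-3) by (simp_all flip: bop_times_apply)
  have P: "range_proj N (X \<bullet>\<^sub>v h) = X \<bullet>\<^sub>v range_proj N h" for N h
    by (simp add: range_proj_def XT)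
  have "word_sum N m (X \<bullet>\<^sub>v h) = Y \<bullet>\<^sub>v word_sum N m h" for N m h
  proof (induction m arbitrary: h)
    case (Suc m)
    have w: "w (sqrt (Suc m) *\<^sub>R (X \<bullet>\<^sub>v h - range_proj N (X \<bullet>\<^sub>v h)) + range_proj N (X \<bullet>\<^sub>v h)) =
        Y \<bullet>\<^sub>v w (sqrt (Suc m) *\<^sub>R (h - range_proj N h) + range_proj N h)"
      unfolding assms(4)[symmetric] by (simp add: P scaleR_scaleC)
    show ?case unfolding word_sum.simps w by (simp only: XT Suc YL bop_apply_linear_simps)
  qed simp
  then show ?thesis by (intro approx_intertwinedI[of 0 _ _ 0]) simp
qed

lemma approx_intertwined_one: "approx_intertwined 1 1"
  by (rule approx_intertwined_exact) (simp_all add: bop_one_apply)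

section \<open>Algebraic and norm closure of intertwined pairs\<close>

lemma approx_intertwined_add:
  assumes "approx_intertwined X Y" "approx_intertwined X' Y'"
  shows "approx_intertwined (X + X') (Y + Y')"
  unfolding approx_intertwined_def
proof (intro allI impI)
  fix e :: real assume "e > 0"
  then have "e / 2 > 0" by simp
  note ev = assms[unfolded approx_intertwined_def, rule_format, OF this]
  show "\<forall>\<^sub>F n in sequentially. \<forall>h.
      norm ((Y + Y') \<bullet>\<^sub>v word_sum n n h - word_sum n n ((X + X') \<bullet>\<^sub>v h)) \<le> e * (sqrt n * norm h)"
    using ev
  proof eventually_elim
    case (elim n)
    show ?case
    proof
      fix h
      have "(Y + Y') \<bullet>\<^sub>v word_sum n n h - word_sum n n ((X + X') \<bullet>\<^sub>v h) =
          (Y \<bullet>\<^sub>v word_sum n n h - word_sum n n (X \<bullet>\<^sub>v h)) + (Y' \<bullet>\<^sub>v word_sum n n h - word_sum n n (X' \<bullet>\<^sub>v h))"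
        by (simp add: bop_add_apply word_sum_add)
      then show "norm ((Y + Y') \<bullet>\<^sub>v word_sum n n h - word_sum n n ((X + X') \<bullet>\<^sub>v h)) \<le> e * (sqrt n * norm h)"
        using norm_triangle_mono[OF elim(1)[rule_format, of h] elim(2)[rule_format, of h]] by (simp add: mult_ac)
    qed
  qed
qed

lemma approx_intertwined_mult:
  assumes "approx_intertwined X Y" "approx_intertwined X' Y'"
  shows "approx_intertwined (X * X') (Y * Y')"
  unfolding approx_intertwined_def
proof (intro allI impI)
  fix e :: real assume "e > 0"
  \<comment> \<open>The two error terms will carry the factors \<open>norm Y\<close> and
    \<open>norm X'\<close>; adding 1 keeps the denominator positive.\<close>
  define d where "d = e / (norm Y + norm X' + 1)"
  have pos: "norm Y + norm X' + 1 > 0" by (smt (verit) norm_ge_zero)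
  then have "d > 0" using \<open>e > 0\<close> by (simp add: d_def)
  note ev = assms[unfolded approx_intertwined_def, rule_format, OF this]
  show "\<forall>\<^sub>F n in sequentially. \<forall>h.
      norm ((Y * Y') \<bullet>\<^sub>v word_sum n n h - word_sum n n ((X * X') \<bullet>\<^sub>v h)) \<le> e * (sqrt n * norm h)"
    using ev
  proof eventually_elim
    case (elim n)
    show ?case
    proof
      fix h
      \<comment> \<open>Exchange one factor at a time, with the intermediate term \<open>Y\<close>
        applied to the word sum of \<open>X' h\<close>.\<close>
      have "(Y * Y') \<bullet>\<^sub>v word_sum n n h - word_sum n n ((X * X') \<bullet>\<^sub>v h) =
          Y \<bullet>\<^sub>v (Y' \<bullet>\<^sub>v word_sum n n h - word_sum n n (X' \<bullet>\<^sub>v h)) +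
          (Y \<bullet>\<^sub>v word_sum n n (X' \<bullet>\<^sub>v h) - word_sum n n (X \<bullet>\<^sub>v (X' \<bullet>\<^sub>v h)))"
        by (simp add: bop_times_apply)
      moreover have "norm (Y \<bullet>\<^sub>v (Y' \<bullet>\<^sub>v word_sum n n h - word_sum n n (X' \<bullet>\<^sub>v h))) \<le> norm Y * (d * (sqrt n * norm h))"
        using norm_bop_apply_le[of Y] elim(2)[rule_format, of h] by (meson mult_left_mono norm_ge_zero order_trans)
      moreover have "norm (Y \<bullet>\<^sub>v word_sum n n (X' \<bullet>\<^sub>v h) - word_sum n n (X \<bullet>\<^sub>v (X' \<bullet>\<^sub>v h))) \<le>
          d * (sqrt n * (norm X' * norm h))"
        using elim(1)[rule_format, of "X' \<bullet>\<^sub>v h"] \<open>d > 0\<close> norm_bop_apply_le[of X' h]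
        by (meson less_imp_le mult_left_mono order_trans real_sqrt_ge_zero of_nat_0_le_iff)
      ultimately have "norm ((Y * Y') \<bullet>\<^sub>v word_sum n n h - word_sum n n ((X * X') \<bullet>\<^sub>v h)) \<le>
          norm Y * (d * (sqrt n * norm h)) + d * (sqrt n * (norm X' * norm h))"
        by (metis norm_triangle_mono)
      also have "\<dots> = (norm Y + norm X') * d * (sqrt n * norm h)" by (simp add: algebra_simps)
      also have "\<dots> \<le> e * (sqrt n * norm h)"
        using pos \<open>e > 0\<close> by (intro mult_right_mono) (auto simp: d_def field_simps)
      finally show "norm ((Y * Y') \<bullet>\<^sub>v word_sum n n h - word_sum n n ((X * X') \<bullet>\<^sub>v h)) \<le> e * (sqrt n * norm h)" .
    qed
  qed
qed

text \<open>A three-epsilon argument: the replacement errors scale with \<open>sqrt n\<close>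
  exactly as the tolerance does, since word sums are multiples of isometries.\<close>

lemma approx_intertwined_limit:
  assumes "\<And>e. e > 0 \<Longrightarrow> \<exists>X' Y'. approx_intertwined X' Y' \<and> norm (X' - X) \<le> e \<and> norm (Y - Y') \<le> e"
  shows "approx_intertwined X Y"
  unfolding approx_intertwined_def
proof (intro allI impI)
  fix e :: real assume "e > 0"
  then have e3: "e / 3 > 0" by simp
  then obtain X' Y' where *: "approx_intertwined X' Y'" "norm (X' - X) \<le> e / 3" "norm (Y - Y') \<le> e / 3"
    using assms by blast
  from *(1)[unfolded approx_intertwined_def, rule_format, OF e3]
  show "\<forall>\<^sub>F n in sequentially. \<forall>h.
      norm (Y \<bullet>\<^sub>v word_sum n n h - word_sum n n (X \<bullet>\<^sub>v h)) \<le> e * (sqrt n * norm h)"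
  proof eventually_elim
    case (elim n)
    show ?case
    proof
      fix h
      have eq: "Y \<bullet>\<^sub>v word_sum n n h - word_sum n n (X \<bullet>\<^sub>v h) = (Y - Y') \<bullet>\<^sub>v word_sum n n h +
          (Y' \<bullet>\<^sub>v word_sum n n h - word_sum n n (X' \<bullet>\<^sub>v h)) + word_sum n n ((X' - X) \<bullet>\<^sub>v h)"
        by (simp add: bop_diff_apply word_sum_diff)
      have "norm ((Y - Y') \<bullet>\<^sub>v word_sum n n h) \<le> e / 3 * (sqrt n * norm h)"
        using norm_bop_apply_le[of "Y - Y'" "word_sum n n h"] mult_right_mono[OF *(3), of "sqrt n * norm h"]
        by (simp add: norm_word_sum)
      moreover have "norm (word_sum n n ((X' - X) \<bullet>\<^sub>v h)) \<le> e / 3 * (sqrt n * norm h)"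
      proof -
        have "norm ((X' - X) \<bullet>\<^sub>v h) \<le> e / 3 * norm h"
          using norm_bop_apply_le[of "X' - X" h] mult_right_mono[OF *(2), of "norm h"] by simp
        then have "sqrt n * norm ((X' - X) \<bullet>\<^sub>v h) \<le> sqrt n * (e / 3 * norm h)"
          by (rule mult_left_mono) simp
        then show ?thesis by (simp add: norm_word_sum mult_ac)
      qed
      ultimately have "norm (Y \<bullet>\<^sub>v word_sum n n h - word_sum n n (X \<bullet>\<^sub>v h)) \<le>
          e / 3 * (sqrt n * norm h) + e / 3 * (sqrt n * norm h) + e / 3 * (sqrt n * norm h)"
        unfolding eq using elim[rule_format, of h] by (intro norm_triangle_mono)
      then show "norm (Y \<bullet>\<^sub>v word_sum n n h - word_sum n n (X \<bullet>\<^sub>v h)) \<le> e * (sqrt n * norm h)" by (simp add: mult_ac)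
    qed
  qed
qed

lemma approx_intertwined_scaleC:
  assumes "approx_intertwined X Y"
  shows "approx_intertwined (c *\<^sub>C X) (c *\<^sub>C Y)"
proof -
  have "approx_intertwined (c *\<^sub>C 1) (c *\<^sub>C 1)"
    by (rule approx_intertwined_exact) (simp_all add: bop_one_apply bop_scaleC_apply w_scaleC)
  from approx_intertwined_mult[OF this assms] show ?thesis by simp
qed

text \<open>The word sum of \<open>X h\<close> has norm \<open>sqrt n * norm (X h)\<close> and
  nearly equals \<open>Y\<close> applied to the word sum of \<open>h\<close>. Dividing by
  \<open>sqrt n\<close> leaves an arbitrarily small error.\<close>

lemma approx_intertwined_norm_le:
  assumes "approx_intertwined X Y"
  shows "norm X \<le> norm Y"
proof (rule norm_bop_bound)
  fix h
  show "norm (X \<bullet>\<^sub>v h) \<le> norm Y * norm h"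
  proof (rule field_le_epsilon)
    fix e :: real assume "e > 0"
    define d where "d = e / (norm h + 1)"
    have h1: "norm h + 1 > 0" by (smt (verit) norm_ge_zero)
    then have "d > 0" using \<open>e > 0\<close> by (simp add: d_def)
    from assms[unfolded approx_intertwined_def, rule_format, OF this]
    have "\<forall>\<^sub>F n in sequentially.
        norm (Y \<bullet>\<^sub>v word_sum n n h - word_sum n n (X \<bullet>\<^sub>v h)) \<le> d * (sqrt n * norm h) \<and> n > 0"
      by (intro eventually_conj eventually_gt_at_top) (auto elim: eventually_mono)
    then obtain n :: nat where n: "n > 0"
      "norm (Y \<bullet>\<^sub>v word_sum n n h - word_sum n n (X \<bullet>\<^sub>v h)) \<le> d * (sqrt n * norm h)"
      by (auto simp: eventually_sequentially)
    have "sqrt n * norm (X \<bullet>\<^sub>v h) \<le> norm (Y \<bullet>\<^sub>v word_sum n n h) + d * (sqrt n * norm h)"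
      using n(2) norm_triangle_ineq2[of "word_sum n n (X \<bullet>\<^sub>v h)" "Y \<bullet>\<^sub>v word_sum n n h"]
      by (simp add: norm_word_sum norm_minus_commute)
    also have "\<dots> \<le> norm Y * (sqrt n * norm h) + d * (sqrt n * norm h)"
      using norm_bop_apply_le[of Y "word_sum n n h"] by (simp add: norm_word_sum)
    also have "\<dots> = sqrt n * (norm Y * norm h + d * norm h)" by (simp add: algebra_simps)
    finally have "norm (X \<bullet>\<^sub>v h) \<le> norm Y * norm h + d * norm h" using n(1) by simp
    moreover have "d * norm h \<le> e" using \<open>e > 0\<close> h1 by (simp add: d_def field_simps)
    ultimately show "norm (X \<bullet>\<^sub>v h) \<le> norm Y * norm h + e" by simp
  qed
qed simp

end

section \<open>Comparison of the tensor norms\<close>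

lemma tensor_lift_rep:
  "cbilinear f \<Longrightarrow> tensor_lift f t = (\<Sum>(x, y)\<leftarrow>rep_alg_tensor t. f x y)"
  by (simp add: tensor_lift_def)

text \<open>The bound depends only on the chosen representative of \<open>t\<close>, not on
  \<open>f\<close>; this makes the supremum in the maximal norm finite.\<close>

lemma norm_tensor_lift_le:
  fixes f :: "'a::complex_normed_vector \<Rightarrow> 'b::complex_normed_vector \<Rightarrow> 'c::complex_normed_vector"
  assumes "cbilinear f" "\<And>x y. norm (f x y) \<le> norm x * norm y"
  shows "norm (tensor_lift f t) \<le> (\<Sum>(x, y)\<leftarrow>rep_alg_tensor t. norm x * norm y)"
proof -
  have "norm (\<Sum>(x, y)\<leftarrow>l. f x y) \<le> (\<Sum>(x, y)\<leftarrow>l. norm x * norm y)" for l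
  proof (induction l)
    case (Cons p l)
    then show ?case using assms(2)[of "fst p" "snd p"]
      by (auto simp: case_prod_unfold intro: norm_triangle_mono)
  qed simp
  then show ?thesis by (simp add: tensor_lift_rep assms)
qed

lemma tensor_lift_hom:
  assumes f: "cbilinear f" and \<sigma>: "unital_star_hom \<sigma>"
  shows "tensor_lift (\<lambda>x y. \<sigma> (f x y)) t = \<sigma> (tensor_lift f t)"
proof -
  note hom = unital_star_homD[OF \<sigma>]
  have "cbilinear (\<lambda>x y. \<sigma> (f x y))" using f by (simp add: cbilinear_def clinear_def hom)
  moreover have "(\<Sum>(x, y)\<leftarrow>l. \<sigma> (f x y)) = \<sigma> (\<Sum>(x, y)\<leftarrow>l. f x y)" for l
    by (induction l) (auto simp: hom)
  ultimately show ?thesis by (simp add: tensor_lift_rep f)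
qed

lemma cbilinear_mult_hom:
  "unital_star_hom \<pi> \<Longrightarrow> unital_star_hom \<rho> \<Longrightarrow> cbilinear (\<lambda>x y. \<pi> x * \<rho> y)"
  by (simp add: cbilinear_def clinear_def unital_star_homD algebra_simps)

lemma op_tensor_pair_as_commuting_pair:
  assumes inf: "infinite (UNIV :: ('a \<times> 'b) set)"
  fixes t :: "('a::cstar_algebra, 'b::cstar_algebra) alg_tensor"
    and \<pi> :: "'a \<Rightarrow> ('a \<times> 'b) bop" and \<rho> :: "'b \<Rightarrow> ('a \<times> 'b) bop"
  assumes \<pi>: "unital_star_hom \<pi>" and \<rho>: "unital_star_hom \<rho>"
  shows "\<exists>(\<pi>' :: 'a \<Rightarrow> ('a \<times> 'b) bop) (\<rho>' :: 'b \<Rightarrow> ('a \<times> 'b) bop).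
    norm (tensor_lift (\<lambda>x y. op_tensor (\<pi> x) (\<rho> y)) t) = norm (tensor_lift (\<lambda>x y. \<pi>' x * \<rho>' y) t) \<and>
    unital_star_hom \<pi>' \<and> unital_star_hom \<rho>' \<and> (\<forall>x y. \<pi>' x * \<rho>' y = \<rho>' y * \<pi>' x)"
proof -
  obtain e :: "('a \<times> 'b) \<times> ('a \<times> 'b) \<Rightarrow> 'a \<times> 'b" where e: "bij e"
    using infinite_UNIV_self_product(1)[OF inf] by blast
  note r = unital_star_hom_bop_reindex[OF e]
  define \<pi>' \<rho>' where "\<pi>' x = bop_reindex e (op_tensor (\<pi> x) 1)" and "\<rho>' y = bop_reindex e (op_tensor 1 (\<rho> y))"
    for x y
  have "unital_star_hom \<pi>'" "unital_star_hom \<rho>'"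
    unfolding \<pi>'_def \<rho>'_def
    by (rule unital_star_hom_compose[OF unital_star_hom_compose[OF \<pi> unital_star_hom_op_tensor_left] r]
        unital_star_hom_compose[OF unital_star_hom_compose[OF \<rho> unital_star_hom_op_tensor_right] r])+
  moreover have m: "\<pi>' x * \<rho>' y = bop_reindex e (op_tensor (\<pi> x) (\<rho> y))"
    "\<rho>' y * \<pi>' x = bop_reindex e (op_tensor (\<pi> x) (\<rho> y))" for x y
    by (simp_all add: \<pi>'_def \<rho>'_def op_tensor_mult flip: unital_star_homD(3)[OF r])
  ultimately show ?thesis
    by (intro exI[of _ \<pi>'] exI[of _ \<rho>'])
      (simp add: tensor_lift_hom[OF cbilinear_op_tensor_hom[OF \<pi> \<rho>] r] norm_bop_reindex[OF e])
qed

text \<open>The intertwined elements form a C*-subalgebra containing the generators, hence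
  everything. Multiplying by the exactly intertwined \<open>\<rho> y\<close> and summing carries
  this to \<open>t\<close>, and intertwining gives the norm inequality. The representation
  \<open>\<rho>\<close> is kept unchanged.\<close>

lemma commuting_pair_norm_le_tensor_norm:
  fixes S :: "nat \<Rightarrow> 'o::cstar_algebra" and t :: "('o, 'a::cstar_algebra) alg_tensor"
    and \<pi> :: "'o \<Rightarrow> 'i bop" and \<rho> :: "'a \<Rightarrow> 'i bop"
  assumes S: "is_cuntz_infinity S" and inf: "infinite (UNIV :: 'i set)"
    and \<pi>: "unital_star_hom \<pi>" and \<rho>: "unital_star_hom \<rho>"
    and comm: "\<And>x y. \<pi> x * \<rho> y = \<rho> y * \<pi> x"
  shows "\<exists>\<phi> :: 'o \<Rightarrow> 'i bop. unital_star_hom \<phi> \<and>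
    norm (tensor_lift (\<lambda>x y. \<pi> x * \<rho> y) t) \<le> norm (tensor_lift (\<lambda>x y. op_tensor (\<phi> x) (\<rho> y)) t)"
proof -
  obtain \<phi> :: "'o \<Rightarrow> 'i bop" and k where \<phi>: "unital_star_hom \<phi>"
    and vac: "\<And>i. (\<phi> (S i))\<^sup>\<star> \<bullet>\<^sub>v ell2_basis k = 0"
    using vacuum_representation[OF S inf] by blast
  define \<psi> :: "'o \<Rightarrow> ('i \<times> 'i) bop" where "\<psi> x = op_tensor (\<phi> x) 1" for x
  have \<psi>: "unital_star_hom \<psi>"
    unfolding \<psi>_def by (rule unital_star_hom_compose[OF \<phi> unital_star_hom_op_tensor_left])
  note \<pi>s = unital_star_homD[OF \<pi>] and \<psi>s = unital_star_homD[OF \<psi>]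
  have cS: "cuntz_isometries S" using S by (simp add: is_cuntz_infinity_def)
  interpret isometries_with_vacuum "\<lambda>i. \<pi> (S i)" "\<lambda>i. \<psi> (S i)" "\<lambda>h. ell2_basis k \<otimes>\<^sub>h h"
    by unfold_locales
      (simp_all add: cuntz_isometries_hom_orthogonal[OF cS \<pi>] cuntz_isometries_hom_orthogonal[OF cS \<psi>]
        ell2_tensor_add_right ell2_tensor_scaleC_right norm_ell2_basis_tensor,
       simp add: \<psi>_def op_tensor_star op_tensor_apply vac ell2_tensor_zero_left)
  \<comment> \<open>Both representations are contractive, so approximation in the algebra carries
    over to the operators.\<close>
  have limit: "approx_intertwined (\<pi> x) (\<psi> x)"
    if approx: "\<And>e. e > 0 \<Longrightarrow> \<exists>y. approx_intertwined (\<pi> y) (\<psi> y) \<and> norm (y - x) \<le> e" for x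
  proof (rule approx_intertwined_limit)
    fix e :: real assume "e > 0"
    then obtain y where y: "approx_intertwined (\<pi> y) (\<psi> y)" "norm (y - x) \<le> e" using approx by blast
    have "norm (\<pi> y - \<pi> x) \<le> e" "norm (\<psi> x - \<psi> y) \<le> e"
      using y(2) unital_star_hom_norm_le[OF \<pi>, of "y - x"] unital_star_hom_norm_le[OF \<psi>, of "x - y"]
      by (simp_all add: \<pi>s(6) \<psi>s(6) norm_minus_commute)
    with y(1) show "\<exists>X' Y'. approx_intertwined X' Y' \<and> norm (X' - \<pi> x) \<le> e \<and> norm (\<psi> x - Y') \<le> e"
      by blast
  qed
  \<comment> \<open>Including the condition on the adjoint makes \<open>B\<close> closed under the
    involution by construction.\<close>
  define B where "B = {x. approx_intertwined (\<pi> x) (\<psi> x) \<and> approx_intertwined (\<pi> (x\<^sup>\<star>)) (\<psi> (x\<^sup>\<star>))}"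
  have "cstar_subalgebra B"
    unfolding cstar_subalgebra_def
  proof (intro conjI ballI allI)
    have "x \<in> B" if "x \<in> closure B" for x
    proof -
      have ap: "\<exists>y. approx_intertwined (\<pi> y) (\<psi> y) \<and> approx_intertwined (\<pi> (y\<^sup>\<star>)) (\<psi> (y\<^sup>\<star>)) \<and>
          norm (y - x) \<le> e \<and> norm (y\<^sup>\<star> - x\<^sup>\<star>) \<le> e" if e: "e > 0" for e
      proof -
        obtain y where "y \<in> B" "norm (y - x) < e"
          using \<open>x \<in> closure B\<close> e by (auto simp: closure_approachable dist_norm)
        then show ?thesis by (intro exI[of _ y]) (simp add: B_def flip: star_diff)
      qed
      have "approx_intertwined (\<pi> x) (\<psi> x)" by (rule limit) (use ap in blast)
      moreover have "approx_intertwined (\<pi> (x\<^sup>\<star>)) (\<psi> (x\<^sup>\<star>))" by (rule limit) (use ap in blast)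
      ultimately show ?thesis by (simp add: B_def)
    qed
    then show "closed B" using closure_subset_eq[of B] by blast
  qed (auto simp: B_def \<pi>s(1-3,5) \<psi>s(1-3,5) star_add star_scaleC star_mult approx_intertwined_one
      intro: approx_intertwined_add approx_intertwined_mult approx_intertwined_scaleC)
  moreover have "range S \<subseteq> B"
    using approx_intertwined_T approx_intertwined_star_T by (auto simp: B_def \<pi>s(4) \<psi>s(4))
  ultimately have "cstar_generated (range S) \<subseteq> B" by (auto simp: cstar_generated_def)
  then have left: "approx_intertwined (\<pi> x) (\<psi> x)" for x
    using S by (auto simp: is_cuntz_infinity_def B_def)
  \<comment> \<open>Rewriting adjoints of \<open>\<pi> (S i)\<close> as values of
    \<open>\<pi>\<close> lets \<open>comm\<close> cover them as well.\<close>
  have right: "approx_intertwined (\<rho> y) (op_tensor 1 (\<rho> y))" for y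
    by (rule approx_intertwined_exact)
      (simp_all add: comm \<psi>_def op_tensor_mult op_tensor_apply bop_one_apply flip: \<pi>s(4))
  have both: "approx_intertwined (\<pi> x * \<rho> y) (op_tensor (\<phi> x) (\<rho> y))" for x y
    using approx_intertwined_mult[OF left right, of x y] by (simp add: \<psi>_def op_tensor_mult)
  have "approx_intertwined (\<Sum>(x, y)\<leftarrow>l. \<pi> x * \<rho> y) (\<Sum>(x, y)\<leftarrow>l. op_tensor (\<phi> x) (\<rho> y))" for l
  proof (induction l)
    case Nil
    show ?case using left[of 0] by (simp add: \<pi>s(7) \<psi>s(7))
  qed (auto intro: approx_intertwined_add both)
  then have "norm (tensor_lift (\<lambda>x y. \<pi> x * \<rho> y) t) \<le> norm (tensor_lift (\<lambda>x y. op_tensor (\<phi> x) (\<rho> y)) t)"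
    by (simp add: tensor_lift_rep cbilinear_mult_hom[OF \<pi> \<rho>] cbilinear_op_tensor_hom[OF \<phi> \<rho>]
        approx_intertwined_norm_le)
  with \<phi> show ?thesis by blast
qed

theorem theorem4p3:
  fixes S :: "nat \<Rightarrow> 'o::cstar_algebra"
  assumes "is_cuntz_infinity S"
  shows "\<forall>t :: ('o, 'a::cstar_algebra) alg_tensor. min_tensor_norm t = max_tensor_norm t"
proof
  fix t :: "('o, 'a) alg_tensor"
  \<comment> \<open>A unital real algebra with \<open>1 \<noteq> 0\<close> has characteristic zero,
    hence infinitely many elements.\<close>
  have inf: "infinite (UNIV :: ('o \<times> 'a) set)"
    by (simp add: finite_prod infinite_UNIV_char_0)
  define Mi Ma where
    "Mi = {norm (tensor_lift (\<lambda>x y. op_tensor (\<pi> x) (\<rho> y)) t) |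
      (\<pi> :: 'o \<Rightarrow> ('o \<times> 'a) bop) (\<rho> :: 'a \<Rightarrow> ('o \<times> 'a) bop). unital_star_hom \<pi> \<and> unital_star_hom \<rho>}"
    and "Ma = {norm (tensor_lift (\<lambda>x y. \<pi> x * \<rho> y) t) |
      (\<pi> :: 'o \<Rightarrow> ('o \<times> 'a) bop) (\<rho> :: 'a \<Rightarrow> ('o \<times> 'a) bop).
      unital_star_hom \<pi> \<and> unital_star_hom \<rho> \<and> (\<forall>x y. \<pi> x * \<rho> y = \<rho> y * \<pi> x)}"
  have sub: "Mi \<subseteq> Ma"
    using op_tensor_pair_as_commuting_pair[OF inf, of _ _ t] unfolding Mi_def Ma_def by blast
  have dom: "\<exists>m\<in>Mi. r \<le> m" if Ma: "r \<in> Ma" for r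
  proof -
    obtain \<pi> :: "'o \<Rightarrow> ('o \<times> 'a) bop" and \<rho> :: "'a \<Rightarrow> ('o \<times> 'a) bop"
      where r: "r = norm (tensor_lift (\<lambda>x y. \<pi> x * \<rho> y) t)"
        and h: "unital_star_hom \<pi>" "unital_star_hom \<rho>" "\<And>x y. \<pi> x * \<rho> y = \<rho> y * \<pi> x"
      using Ma unfolding Ma_def by blast
    from commuting_pair_norm_le_tensor_norm[OF assms inf h, of t] h(2) show ?thesis
      unfolding Mi_def r by blast
  qed
  \<comment> \<open>Boundedness is what makes the real-valued \<open>Sup\<close> an actual
    supremum.\<close>
  have bdd: "bdd_above Ma"
  proof (rule bdd_aboveI)
    fix r assume "r \<in> Ma"
    then obtain \<pi> :: "'o \<Rightarrow> ('o \<times> 'a) bop" and \<rho> :: "'a \<Rightarrow> ('o \<times> 'a) bop"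
      where r: "r = norm (tensor_lift (\<lambda>x y. \<pi> x * \<rho> y) t)" and h: "unital_star_hom \<pi>" "unital_star_hom \<rho>"
      unfolding Ma_def by blast
    have "norm (\<pi> x * \<rho> y) \<le> norm x * norm y" for x y
      by (rule order_trans[OF norm_mult_ineq mult_mono])
        (simp_all add: unital_star_hom_norm_le h)
    then show "r \<le> (\<Sum>(x, y)\<leftarrow>rep_alg_tensor t. norm x * norm y)"
      unfolding r by (rule norm_tensor_lift_le[OF cbilinear_mult_hom[OF h]])
  qed
  have "Sup Mi = Sup Ma"
  \<comment> \<open>If there are no commuting pairs, \<open>sub\<close> makes both sets empty and
    the two \<open>Sup\<close> terms coincide.\<close>
  proof (cases "Ma = {}")
    case False
    then have "Mi \<noteq> {}" using dom by blast
    then have "Sup Mi \<le> Sup Ma" by (rule cSup_subset_mono[OF _ bdd sub])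
    moreover have "Sup Ma \<le> Sup Mi" by (rule cSup_mono[OF False bdd_above_mono[OF bdd sub] dom])
    ultimately show ?thesis by (rule antisym)
  qed (use sub in simp)
  then show "min_tensor_norm t = max_tensor_norm t"
    by (simp add: min_tensor_norm_def max_tensor_norm_def Mi_def Ma_def)
qed

end
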